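(* Let $\rho$ be a $g$-measure on $A^{\mathbb N}$ associated to $\phi=\log g$, and let $x_1^n$ be a sample path distributed according to $\rho$. Suppose that the sequence of positive integers $(k(n))_{n\in\mathbb N}$ diverges and eventually satisfies $k(n)\leq\frac{1-\epsilon}{\log|A|}\log n$ for some $0<\epsilon<1$. Let $$\mathbf J(u)=u\ \text{ if } u\in\big[0,-\inf\{\mathbb E_\eta[\phi]:\eta\in\mathcal E\}\big],\qquad \mathbf J(u)=+\infty\ \text{ otherwise.}$$ Then each of the sequences of empirical relative entropies $Z_n(x_1^n)=\hat\Delta_{k(n)}(x_1^n|\rho)$ and $Z_n(x_1^n)=\frac1{k(n)}\hat D_{k(n)}(x_1^n|\rho)$ satisfies a large deviation principle with rate function $\mathbf J$: for any closed set $C\subset\mathbb R$, $$\limsup_{n\to\infty}\frac1n\log\rho\{x_1^n:Z_n(x_1^n)\in C\}\leq-\inf\{\mathbf J(u):u\in C\},$$ and for any open set $O\subset\mathbb R$, $$\liminf_{n\to\infty}\frac1n\log\rho\{x_1^n:Z_n(x_1^n)\in O\}\geq-\inf\{\mathbf J(u):u\in O\}.$$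
   Context: $A$ is a finite alphabet; $a_1^k$ denotes the string $(a_1,\dots,a_k)\in A^k$; $T$ is the shift on $A^{\mathbb N}$, $Tx_1^\infty=x_2^\infty$; $[a_1^n]$ is the cylinder of infinite strings beginning with $a_1^n$. For a set $S$ of strings $x_1^n\in A^n$, $\rho(S)=\sum_{x_1^n\in S}\rho([x_1^n])$. $\mathcal M_s$ is the set of shift-invariant Borel probability measures on $A^{\mathbb N}$ and $\mathcal E\subset\mathcal M_s$ the ergodic ones; $\mathbb E_\nu$ is expectation with respect to $\nu$; $h(\nu)$ is the Shannon-Kolmogorov-Sinai entropy of $\nu\in\mathcal M_s$. $g$-measures: $g:A^{\mathbb N}\to(0,1)$ is a continuous, strictly positive function with $\sum_{b_1^\infty:Tb_1^\infty=a_1^\infty}g(b_1^\infty)=1$ for all $a_1^\infty$; $\phi=\log g$. An equilibrium state of a continuous $\psi:A^{\mathbb N}\to\mathbb R$ is a measure in $\mathcal M_s$ attaining $\sup\{\mathbb E_\eta[\psi]+h(\eta):\eta\in\mathcal M_s\}$. A $g$-measure is an equilibrium state of $\phi=\log g$ (not assumed unique); $\rho$ is one fixed such measure and $\rho_k(a_1^k)=\rho([a_1^k])$. Empirical relative entropies: for $x_1^n\in A^n$ let $\tilde x_1^\infty$ be its $n$-periodic extension $x_1^nx_1^nx_1^n\cdots$ and $\pi_k(a_1^k;x_1^n)=\frac1n\#\{1\le i\le n:\tilde x_i^{i+k-1}=a_1^k\}$. For a probability measure $\nu_k$ on $A^k$, with $\nu_{k-1}(a_1^{k-1})=\sum_b\nu_k(a_1^{k-1}b)$,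 let $D_k(\nu_k|\rho_k)=\sum_{a_1^k}\nu_k(a_1^k)\log\frac{\nu_k(a_1^k)}{\rho_k(a_1^k)}$, $D_0=0$, and $\Delta_k(\nu_k|\rho_k)=D_k(\nu_k|\rho_k)-D_{k-1}(\nu_{k-1}|\rho_{k-1})$ (convention $0\log 0=0$). Then $\hat D_k(x_1^n|\rho)=D_k(\pi_k(\cdot;x_1^n)|\rho_k)$ and $\hat\Delta_k(x_1^n|\rho)=\Delta_k(\pi_k(\cdot;x_1^n)|\rho_k)$. *)

theory Defs
  imports "HOL-Probability.Probability"
begin

section \<open>Infinite and finite strings\<close>

text \<open>
  The alphabet is a finite type \<open>'a\<close>, an infinite string is a function \<open>nat \<Rightarrow> 'a\<close>. Positions are
  counted from 0, so \<open>x i\<close> is the letter usually written with index \<open>i + 1\<close>. A finite string is a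
  list.
\<close>

definition seq_topology :: "(nat \<Rightarrow> 'a) topology" where
  "seq_topology = product_topology (\<lambda>_. discrete_topology UNIV) UNIV"

definition seq_borel :: "(nat \<Rightarrow> 'a) measure" where
  "seq_borel = sigma UNIV {U. openin seq_topology U}"

definition shift :: "(nat \<Rightarrow> 'a) \<Rightarrow> (nat \<Rightarrow> 'a)" where
  "shift x = (\<lambda>i. x (Suc i))"

definition strings :: "nat \<Rightarrow> 'a list set" where
  "strings n = {xs. length xs = n}"

definition cylinder :: "'a list \<Rightarrow> (nat \<Rightarrow> 'a) set" where
  "cylinder xs = {x. \<forall>i < length xs. x i = xs ! i}"

definition block_prob :: "(nat \<Rightarrow> 'a) measure \<Rightarrow> 'a list \<Rightarrow> real" where
  "block_prob \<mu> xs = measure \<mu> (cylinder xs)"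

text \<open>The measure of a set \<open>S\<close> of strings of one common length.\<close>

definition strings_prob :: "(nat \<Rightarrow> 'a) measure \<Rightarrow> 'a list set \<Rightarrow> real" where
  "strings_prob \<mu> S = (\<Sum>xs\<in>S. block_prob \<mu> xs)"


section \<open>Invariant measures, entropy, equilibrium states\<close>

definition invariant_measures :: "(nat \<Rightarrow> 'a) measure set" where
  "invariant_measures =
     {\<mu>. sets \<mu> = sets seq_borel \<and> prob_space \<mu> \<and> distr \<mu> seq_borel shift = \<mu>}"

definition ergodic_measures :: "(nat \<Rightarrow> 'a) measure set" where
  "ergodic_measures =
     {\<mu> \<in> invariant_measures. \<forall>B \<in> sets seq_borel. shift -` B = B \<longrightarrow> measure \<mu> B = 0 \<or> measure \<mu> B = 1}"

text \<open>
  The entropy of the shift under \<open>\<mu>\<close> as the entropy rate of the process, i.e. the limit of the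
  normalised Shannon block entropies. The limit exists for every invariant measure. Logarithms are
  natural, and \<open>0 * ln 0 = 0\<close> holds in HOL.
\<close>

definition block_entropy :: "nat \<Rightarrow> (nat \<Rightarrow> 'a) measure \<Rightarrow> real" where
  "block_entropy n \<mu> = - (\<Sum>xs\<in>strings n. block_prob \<mu> xs * ln (block_prob \<mu> xs))"

definition measure_entropy :: "(nat \<Rightarrow> 'a) measure \<Rightarrow> real" where
  "measure_entropy \<mu> = lim (\<lambda>n. block_entropy n \<mu> / real n)"

definition equilibrium_state :: "((nat \<Rightarrow> 'a) \<Rightarrow> real) \<Rightarrow> (nat \<Rightarrow> 'a) measure \<Rightarrow> bool" where
  "equilibrium_state \<psi> \<mu> \<longleftrightarrow>
     \<mu> \<in> invariant_measures \<and>
     (\<forall>\<eta> \<in> invariant_measures.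
        (\<integral>x. \<psi> x \<partial>\<eta>) + measure_entropy \<eta> \<le> (\<integral>x. \<psi> x \<partial>\<mu>) + measure_entropy \<mu>)"

definition g_function :: "((nat \<Rightarrow> 'a) \<Rightarrow> real) \<Rightarrow> bool" where
  "g_function g \<longleftrightarrow>
     continuous_map seq_topology euclideanreal g \<and>
     (\<forall>x. 0 < g x \<and> g x < 1) \<and>
     (\<forall>a. (\<Sum>b \<in> {b. shift b = a}. g b) = 1)"

definition g_measure :: "((nat \<Rightarrow> 'a) \<Rightarrow> real) \<Rightarrow> (nat \<Rightarrow> 'a) measure \<Rightarrow> bool" where
  "g_measure g \<rho> \<longleftrightarrow> g_function g \<and> equilibrium_state (\<lambda>x. ln (g x)) \<rho>"


section \<open>Empirical relative entropies\<close>

definition periodic_ext :: "'a list \<Rightarrow> (nat \<Rightarrow> 'a)" where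
  "periodic_ext xs = (\<lambda>i. xs ! (i mod length xs))"

definition empirical_prob :: "'a list \<Rightarrow> 'a list \<Rightarrow> real" where
  "empirical_prob xs as =
     real (card {i. i < length xs \<and> map (periodic_ext xs) [i ..< i + length as] = as}) / real (length xs)"

text \<open>
  A distribution on strings of length \<open>k\<close> is a function on lists of which only the values on
  \<open>strings k\<close> are used. For \<open>\<rho>\<close> giving positive mass to all cylinders (as every g-measure does) the
  summands below have their usual meaning.
\<close>

definition rel_entropy :: "nat \<Rightarrow> ('a list \<Rightarrow> real) \<Rightarrow> (nat \<Rightarrow> 'a) measure \<Rightarrow> real" where
  "rel_entropy k \<nu> \<rho> =
     (if k = 0 then 0 else \<Sum>as\<in>strings k. \<nu> as * ln (\<nu> as / block_prob \<rho> as))"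

definition marginal :: "('a::finite list \<Rightarrow> real) \<Rightarrow> 'a list \<Rightarrow> real" where
  "marginal \<nu> as = (\<Sum>b\<in>UNIV. \<nu> (as @ [b]))"

definition cond_rel_entropy :: "nat \<Rightarrow> ('a::finite list \<Rightarrow> real) \<Rightarrow> (nat \<Rightarrow> 'a) measure \<Rightarrow> real" where
  "cond_rel_entropy k \<nu> \<rho> = rel_entropy k \<nu> \<rho> - rel_entropy (k - 1) (marginal \<nu>) \<rho>"

definition emp_rel_entropy :: "nat \<Rightarrow> 'a list \<Rightarrow> (nat \<Rightarrow> 'a) measure \<Rightarrow> real" where
  "emp_rel_entropy k xs \<rho> = rel_entropy k (empirical_prob xs) \<rho>"

definition emp_cond_rel_entropy :: "nat \<Rightarrow> 'a::finite list \<Rightarrow> (nat \<Rightarrow> 'a) measure \<Rightarrow> real" where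
  "emp_cond_rel_entropy k xs \<rho> = cond_rel_entropy k (empirical_prob xs) \<rho>"


section \<open>Large deviations\<close>

definition elog :: "real \<Rightarrow> ereal" where
  "elog p = (if p = 0 then -\<infinity> else ereal (ln p))"

definition satisfies_LDP ::
  "(nat \<Rightarrow> 'a) measure \<Rightarrow> (nat \<Rightarrow> 'a list \<Rightarrow> real) \<Rightarrow> (real \<Rightarrow> ereal) \<Rightarrow> bool" where
  "satisfies_LDP \<rho> Z J \<longleftrightarrow>
     (\<forall>C. closed C \<longrightarrow>
        limsup (\<lambda>n. ereal (1 / real n) * elog (strings_prob \<rho> {xs \<in> strings n. Z n xs \<in> C}))
          \<le> - (INF u\<in>C. J u)) \<and>
     (\<forall>U. open U \<longrightarrow>
        liminf (\<lambda>n. ereal (1 / real n) * elog (strings_prob \<rho> {xs \<in> strings n. Z n xs \<in> U}))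
          \<ge> - (INF u\<in>U. J u))"

definition rate_J :: "((nat \<Rightarrow> 'a) \<Rightarrow> real) \<Rightarrow> real \<Rightarrow> ereal" where
  "rate_J \<phi> u =
     (if u \<in> {0 .. - (INF \<eta>\<in>ergodic_measures. \<integral>x. \<phi> x \<partial>\<eta>)} then ereal u else \<infinity>)"

end

theory Submission
  imports Defs "HOL-Real_Asymp.Real_Asymp"
begin

text \<open>
  Write \<open>\<phi> = ln g\<close>, \<open>S\<^sub>n \<phi>\<close> for the Birkhoff sum along the \<open>n\<close>-periodic extension of a string
  \<open>x\<close> of length \<open>n\<close>, and \<open>\<pi>\<close> for the empirical word frequencies of \<open>x\<close>.

  Everything rests on one property of \<open>\<rho>\<close>: the conditional probability of a first letter given
  the letters that follow is a value of \<open>g\<close> on the corresponding cylinder (locale \<open>g_family\<close>).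
  It implies \<open>ln \<rho>(x) = S\<^sub>n \<phi> + o(n)\<close> and
  \<open>ln \<rho>(x\<^sub>1 | x\<^sub>2 \<dots> x\<^sub>k) = \<phi> + o(1)\<close>, uniformly in \<open>x\<close>, and hence
  \<open>Z = - S\<^sub>n \<phi> / n - h + o(1)\<close>, where \<open>Z\<close> is either of the two empirical relative entropies and
  \<open>h\<close> is the empirical conditional entropy of order \<open>k\<close> or the empirical block entropy per letter,
  respectively. The definition of an equilibrium state gives this property as follows. Averages of
  the iterated transfer operator of \<open>g\<close> converge along a subsequence to a stationary law whose
  entropy and integral of \<open>\<phi>\<close> add up to 0 (\<open>g_family_exists\<close>), so they add up to at least 0 for
  \<open>\<rho>\<close>. This bounds the divergence of \<open>\<rho>\<close> on words of length \<open>k\<close> from the law with transition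
  probabilities \<open>g\<close> by the variation of \<open>\<phi>\<close> on cylinders of length \<open>k\<close>
  (\<open>g_measure_hellinger\<close>). Summing over extensions of a fixed word and letting \<open>k\<close> grow yields
  \<open>g_measure_g_family\<close>.

  Upper bound. By the expansion of \<open>Z\<close>, \<open>\<rho>(x) \<le> exp (- n Z - n h + o(n))\<close>, where \<open>h\<close> may be
  lowered to the conditional entropy of order \<open>k\<close> in both cases. Then \<open>exp (- n h)\<close> is the probability of \<open>x\<close> under the Markov chain fitted to \<open>x\<close>, so its sum over all
  strings is at most the number of possible word counts times the number of initial contexts
  (\<open>sum_exp_cond_entropy_le\<close>), which is \<open>exp (o(n))\<close> because \<open>k\<close> grows slowly. Hence
  \<open>\<rho>{Z \<ge> u} \<le> exp (- n u + o(n))\<close> (\<open>upper_tail\<close>). Moreover \<open>0 \<le> Z \<le> u_max + o(1)\<close>, where \<open>u_max\<close>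
  is the right end point in the rate function, because \<open>S\<^sub>n \<phi> / n\<close> is the integral of \<open>\<phi>\<close> over
  the ergodic measure on a periodic orbit.

  Lower bound. Fix a periodic orbit with \<open>\<phi>\<close>-average \<open>- a\<close> and \<open>s\<close> in \<open>[0, 1]\<close>. The strings whose
  last \<open>s n\<close> letters follow this orbit have total probability \<open>exp (- n s a + o(n))\<close>, by shift
  invariance. On all of them \<open>Z \<ge> s a - o(1)\<close>: a fraction \<open>s\<close> of their words of length \<open>k\<close>
  lies in a bounded number of words of probability \<open>exp (- k a + o(k))\<close>. By the upper tail bound
  only a negligible part of them has \<open>Z\<close> above \<open>s a + \<delta>\<close>, so \<open>Z\<close> is close to \<open>s a\<close> on most of them.
  The values \<open>s a\<close> are dense in \<open>[0, u_max]\<close> since periodic orbits nearly minimise the integral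
  of \<open>\<phi>\<close> (\<open>orbit_average_approx\<close>).
\<close>

section \<open>Words and windows\<close>

lemma strings_0: "strings 0 = {[]}"
  by (auto simp: strings_def)

lemma strings_Suc_Cons: "strings (Suc n) = (\<lambda>(w, b). b # w) ` (strings n \<times> UNIV)"
  by (auto simp: strings_def length_Suc_conv image_iff)

lemma strings_Suc_snoc: "strings (Suc n) = (\<lambda>(w, b). w @ [b]) ` (strings n \<times> UNIV)"
  by (auto simp: strings_def length_Suc_conv_rev image_iff)

lemma finite_strings [simp, intro]: "finite (strings n :: 'a::finite list set)"
  by (induction n) (simp_all add: strings_0 strings_Suc_Cons)

lemma card_strings: "card (strings n :: 'a::finite list set) = CARD('a) ^ n"
  using card_lists_length_eq[of "UNIV :: 'a set" n] by (simp add: strings_def)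

lemma sum_strings_Cons:
  "(\<Sum>w\<in>strings (Suc n). f w) = (\<Sum>w\<in>strings n. \<Sum>b\<in>(UNIV :: 'a::finite set). f (b # w))"
  unfolding strings_Suc_Cons
  by (subst sum.reindex) (auto simp: inj_on_def sum.cartesian_product split_def)

lemma sum_strings_snoc:
  "(\<Sum>w\<in>strings (Suc n). f w) = (\<Sum>w\<in>strings n. \<Sum>b\<in>(UNIV :: 'a::finite set). f (w @ [b]))"
  unfolding strings_Suc_snoc
  by (subst sum.reindex) (auto simp: inj_on_def sum.cartesian_product split_def)

definition window :: "(nat \<Rightarrow> 'a) \<Rightarrow> nat \<Rightarrow> nat \<Rightarrow> 'a list" where
  "window x i k = map x [i ..< i + k]"

lemma length_window [simp]: "length (window x i k) = k"
  by (simp add: window_def)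

lemma window_in_strings [simp]: "window x i k \<in> strings k"
  by (simp add: strings_def)

lemma window_0 [simp]: "window x i 0 = []"
  by (simp add: window_def)

lemma nth_window [simp]: "j < k \<Longrightarrow> window x i k ! j = x (i + j)"
  by (simp add: window_def)

lemma window_Suc: "window x i (Suc k) = x i # window x (Suc i) k"
  by (simp add: window_def upt_conv_Cons del: upt_Suc)

lemma window_Suc_snoc: "window x i (Suc k) = window x i k @ [x (i + k)]"
  by (simp add: window_def)

lemma window_eq_iff: "window x i (length w) = w \<longleftrightarrow> (\<forall>j<length w. x (i + j) = w ! j)"
  by (auto simp: list_eq_iff_nth_eq)

lemma funpow_shift: "(shift ^^ i) x = (\<lambda>j. x (i + j))"
  by (induction i) (auto simp: shift_def)

lemma window_funpow_shift: "window ((shift ^^ i) x) j k = window x (i + j) k"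
  by (auto simp: list_eq_iff_nth_eq funpow_shift add.assoc)

lemma cylinder_eq_window: "cylinder w = {x. window x 0 (length w) = w}"
  by (auto simp: cylinder_def window_eq_iff)

section \<open>Divergence inequalities\<close>

text \<open>
  Applying \<open>ln t \<le> t - 1\<close> to a quotient of square roots, rather than to \<open>Q / P\<close>, leaves a square
  over. Summed over a space this bounds the squared Hellinger distance of two probability vectors
  by their divergence.
\<close>

lemma hellinger_pointwise:
  fixes P Q :: real
  assumes "0 \<le> P" "0 \<le> Q" "Q = 0 \<Longrightarrow> P = 0"
  shows "P - Q + (sqrt P - sqrt Q)\<^sup>2 \<le> P * (ln P - ln Q)"
proof (cases "P = 0")
  case True then show ?thesis using assms by simp
next
  case False
  then have pos: "0 < P" "0 < Q" using assms by (auto simp: less_le)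
  define s t where "s = sqrt P" and "t = sqrt Q"
  have st: "0 < s" "0 < t" "P = s\<^sup>2" "Q = t\<^sup>2" using pos by (auto simp: s_def t_def)
  have "s * (ln t - ln s) = s * ln (t / s)" using st by (simp add: ln_div)
  also have "\<dots> \<le> s * (t / s - 1)" using st by (intro mult_left_mono ln_le_minus_one) auto
  also have "\<dots> = t - s" using st by (simp add: field_simps)
  finally have "(2 * s) * (s - t) \<le> (2 * s) * (s * (ln s - ln t))"
    using st by (intro mult_left_mono) (auto simp: algebra_simps)
  also have "\<dots> = P * (ln P - ln Q)" using st by (simp add: ln_realpow power2_eq_square ln_mult algebra_simps)
  finally show ?thesis using st
    unfolding s_def[symmetric] t_def[symmetric] by (simp add: power2_eq_square algebra_simps)
qed

lemma gibbs_pointwise: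
  fixes P Q :: real
  assumes "0 \<le> P" "0 \<le> Q" "Q = 0 \<Longrightarrow> P = 0"
  shows "P - Q \<le> P * (ln P - ln Q)"
  using hellinger_pointwise[OF assms] zero_le_power2[of "sqrt P - sqrt Q"] by linarith

lemma gibbs_inequality:
  fixes P Q :: "'b \<Rightarrow> real"
  assumes "\<And>x. x \<in> X \<Longrightarrow> 0 \<le> P x" "\<And>x. x \<in> X \<Longrightarrow> 0 \<le> Q x"
    "\<And>x. x \<in> X \<Longrightarrow> Q x = 0 \<Longrightarrow> P x = 0"
  shows "(\<Sum>x\<in>X. P x) - (\<Sum>x\<in>X. Q x) \<le> (\<Sum>x\<in>X. P x * (ln (P x) - ln (Q x)))"
  unfolding sum_subtractf[symmetric] by (intro sum_mono gibbs_pointwise) (use assms in auto)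

section \<open>Entropies of stationary word probabilities\<close>

text \<open>
  The word probabilities of a shift-invariant law: extending a word on the right or on the left does
  not change its total probability. Cylinder probabilities of invariant measures and empirical word
  frequencies are both of this kind.
\<close>

locale stationary_family =
  fixes p :: "'a::finite list \<Rightarrow> real"
  assumes nonneg: "0 \<le> p w"
    and Nil: "p [] = 1"
    and snoc: "(\<Sum>b\<in>UNIV. p (w @ [b])) = p w"
    and Cons: "(\<Sum>b\<in>UNIV. p (b # w)) = p w"

definition word_entropy :: "('a list \<Rightarrow> real) \<Rightarrow> nat \<Rightarrow> real" where
  "word_entropy p k = - (\<Sum>w\<in>strings k. p w * ln (p w))"

text \<open>
  The entropy of one letter given the \<open>k\<close> letters that follow it, or equally given the \<open>k\<close>
  letters that precede it.
\<close>

definition cond_entropy :: "('a list \<Rightarrow> real) \<Rightarrow> nat \<Rightarrow> real" where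
  "cond_entropy p k = word_entropy p (Suc k) - word_entropy p k"

context stationary_family
begin

lemma sum_strings: "(\<Sum>w\<in>strings k. p w) = 1"
proof (induction k)
  case (Suc k) then show ?case by (simp add: sum_strings_Cons Cons)
qed (simp add: strings_0 Nil)

lemma Cons_le: "p (b # w) \<le> p w"
  unfolding Cons[of w, symmetric] by (rule member_le_sum) (auto simp: nonneg)

lemma snoc_le: "p (w @ [b]) \<le> p w"
  unfolding snoc[of w, symmetric] by (rule member_le_sum[where f="\<lambda>b. p (w @ [b])"]) (auto simp: nonneg)

lemma sum_prefix: "(\<Sum>u\<in>strings m. p (u @ z)) = p z"
  by (induction m) (simp_all add: strings_0 sum_strings_Cons Cons)

lemma sum_suffix: "(\<Sum>u\<in>strings m. p (z @ u)) = p z"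
proof (induction m)
  case (Suc m)
  then show ?case
    by (simp add: sum_strings_snoc snoc flip: append_assoc)
qed (simp_all add: strings_0)

lemma sum_Cons_tl: "(\<Sum>w\<in>strings (Suc k). p w * f (tl w)) = (\<Sum>w\<in>strings k. p w * f w)"
  by (simp add: sum_strings_Cons Cons flip: sum_distrib_right)

lemma cond_entropy_Cons:
  "cond_entropy p k = - (\<Sum>w\<in>strings (Suc k). p w * (ln (p w) - ln (p (tl w))))"
  unfolding cond_entropy_def word_entropy_def
  using sum_Cons_tl[where f="\<lambda>w. ln (p w)"] by (simp add: right_diff_distrib sum_subtractf)

lemma cond_entropy_snoc:
  "cond_entropy p k = - (\<Sum>w\<in>strings k. \<Sum>b\<in>UNIV. p (w @ [b]) * (ln (p (w @ [b])) - ln (p w)))"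
  unfolding cond_entropy_def word_entropy_def
  by (simp add: right_diff_distrib sum_subtractf sum_strings_snoc snoc flip: sum_distrib_right)

lemma cond_entropy_nonneg: "0 \<le> cond_entropy p k"
proof -
  have "p w * (ln (p w) - ln (p (tl w))) \<le> 0" if "w \<in> strings (Suc k)" for w
  proof (cases "p w = 0")
    case False
    obtain b u where w: "w = b # u" using \<open>w \<in> strings (Suc k)\<close> by (auto simp: strings_def length_Suc_conv)
    have "0 < p w" using False nonneg[of w] by simp
    moreover have "p w \<le> p (tl w)" using Cons_le[of b u] w by simp
    ultimately show ?thesis by (simp add: mult_nonneg_nonpos)
  qed simp
  then show ?thesis unfolding cond_entropy_Cons by (simp add: sum_nonpos)
qed

text \<open>
  Conditioning on more symbols does not increase entropy: the difference of two consecutive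
  conditional entropies is the divergence of the law of \<open>a # w @ [b]\<close> from the law that has the
  same marginals and makes the two end letters conditionally independent given \<open>w\<close>.
\<close>

lemma cond_entropy_Suc_le: "cond_entropy p (Suc k) \<le> cond_entropy p k"
proof -
  let ?D = "\<lambda>w a b. p (a # w @ [b]) * (ln (p (a # w @ [b])) - ln (p (a # w)) - ln (p (w @ [b])) + ln (p w))"
  have pw: "p (a # w @ [b]) - p (a # w) * p (w @ [b]) / p w \<le> ?D w a b" for w a b
  proof (cases "p (a # w @ [b]) = 0")
    case False
    then have P: "0 < p (a # w @ [b])" using nonneg[of "a # w @ [b]"] by simp
    have A: "0 < p (a # w)" using P snoc_le[of "a # w" b] by simp
    have B: "0 < p (w @ [b])" using P Cons_le[of a "w @ [b]"] by simp
    have W: "0 < p w" using B snoc_le[of w b] by simp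
    show ?thesis
      using gibbs_pointwise[of "p (a # w @ [b])" "p (a # w) * p (w @ [b]) / p w"] P A B W
      by (simp add: ln_div ln_mult algebra_simps)
  qed (simp add: nonneg)
  have 1: "(\<Sum>w\<in>strings k. \<Sum>a\<in>UNIV. \<Sum>b\<in>UNIV. p (a # w @ [b])) = 1"
    using sum_strings[of k] by (simp add: snoc Cons flip: append_Cons)
  have 2: "(\<Sum>w\<in>strings k. \<Sum>a\<in>UNIV. \<Sum>b\<in>UNIV. p (a # w) * p (w @ [b]) / p w) = 1"
    using sum_strings[of k]
    by (simp add: snoc Cons sum_product[symmetric] flip: sum_divide_distrib)
  have 3: "cond_entropy p (Suc k)
      = - (\<Sum>w\<in>strings k. \<Sum>a\<in>UNIV. \<Sum>b\<in>UNIV. p (a # w @ [b]) * (ln (p (a # w @ [b])) - ln (p (a # w))))"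
    unfolding cond_entropy_snoc sum_strings_Cons by simp
  have 4: "cond_entropy p k
      = - (\<Sum>w\<in>strings k. \<Sum>a\<in>UNIV. \<Sum>b\<in>UNIV. p (a # w @ [b]) * (ln (p (w @ [b])) - ln (p w)))"
    unfolding cond_entropy_snoc
    by (subst sum.swap[of _ UNIV UNIV]) (simp add: Cons flip: sum_distrib_right)
  have "cond_entropy p k - cond_entropy p (Suc k) = (\<Sum>w\<in>strings k. \<Sum>a\<in>UNIV. \<Sum>b\<in>UNIV. ?D w a b)"
    unfolding 3 4 by (simp add: sum_subtractf[symmetric] algebra_simps)
  moreover have "(\<Sum>w\<in>strings k. \<Sum>a\<in>UNIV. \<Sum>b\<in>UNIV. p (a # w @ [b]) - p (a # w) * p (w @ [b]) / p w)
      \<le> (\<Sum>w\<in>strings k. \<Sum>a\<in>UNIV. \<Sum>b\<in>UNIV. ?D w a b)"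
    by (intro sum_mono pw)
  ultimately show ?thesis using 1 2 by (simp add: sum_subtractf)
qed

lemma decseq_cond_entropy: "decseq (cond_entropy p)"
  by (intro decseq_SucI cond_entropy_Suc_le)

lemma word_entropy_eq_sum: "word_entropy p k = (\<Sum>j<k. cond_entropy p j)"
  by (induction k) (simp_all add: cond_entropy_def word_entropy_def strings_0 Nil)

lemma word_entropy_ge_cond_entropy: "real (Suc k) * cond_entropy p k \<le> word_entropy p (Suc k)"
proof -
  have "(\<Sum>j<Suc k. cond_entropy p k) \<le> (\<Sum>j<Suc k. cond_entropy p j)"
    by (intro sum_mono decseqD[OF decseq_cond_entropy]) auto
  then show ?thesis by (simp add: word_entropy_eq_sum)
qed

end

section \<open>Measures on the sequence space\<close>

lemma topspace_seq_topology [simp]: "topspace seq_topology = UNIV"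
  by (auto simp: seq_topology_def)

lemma mem_cylinder_window [simp]: "x \<in> cylinder (window x 0 k)"
  by (simp add: cylinder_def)

lemma cylinder_window: "y \<in> cylinder (window x 0 k) \<longleftrightarrow> (\<forall>i<k. y i = x i)"
  by (auto simp: cylinder_def)

lemma cylinder_Nil [simp]: "cylinder [] = UNIV"
  by (simp add: cylinder_def)

lemma openin_cylinder: "openin seq_topology (cylinder w)"
proof -
  have "cylinder w = PiE UNIV (\<lambda>i. if i < length w then {w ! i} else UNIV)"
    by (auto simp: cylinder_def PiE_iff split: if_splits)
  moreover have "finite {i. (if i < length w then {w ! i} else UNIV) \<noteq> (UNIV :: 'a set)}"
    by (rule finite_subset[of _ "{..<length w}"]) auto
  ultimately show ?thesis
    unfolding seq_topology_def by (simp del: PiE_UNIV_domain add: product_topology_basis)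
qed

lemma cylinder_nhd:
  assumes U: "openin seq_topology U" and x: "x \<in> U"
  obtains k where "cylinder (window x 0 k) \<subseteq> U"
proof -
  obtain V where V: "finite {i. V i \<noteq> UNIV}" "x \<in> PiE UNIV V" "PiE UNIV V \<subseteq> U"
    using U[unfolded seq_topology_def openin_product_topology_alt] x by auto
  obtain k where k: "{i. V i \<noteq> UNIV} \<subseteq> {..<k}"
    using V(1) finite_nat_iff_bounded by blast
  have "cylinder (window x 0 k) \<subseteq> PiE UNIV V"
  proof
    fix y assume "y \<in> cylinder (window x 0 k)"
    then have "\<forall>i<k. y i = x i" by (simp add: cylinder_window)
    then have "y i \<in> V i" for i
      using k V(2) by (cases "i < k") (auto simp: PiE_iff)
    then show "y \<in> PiE UNIV V" by auto
  qed
  then show thesis using that V(3) by blast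
qed

lemma space_seq_borel [simp]: "space seq_borel = UNIV"
  by (simp add: seq_borel_def)

text \<open>
  There are only countably many words, so every open set is a countable union of cylinders and the
  Borel sets are generated by cylinders.
\<close>

lemma open_eq_Union_cylinder:
  assumes "openin seq_topology U"
  shows "U = (\<Union>w\<in>{w. cylinder w \<subseteq> U}. cylinder w)"
proof (intro equalityI subsetI)
  fix x assume "x \<in> U"
  then obtain k where "cylinder (window x 0 k) \<subseteq> U" by (rule cylinder_nhd[OF assms])
  then show "x \<in> (\<Union>w\<in>{w. cylinder w \<subseteq> U}. cylinder w)" using mem_cylinder_window by blast
qed auto

lemma sets_seq_borel: "sets seq_borel = sigma_sets UNIV (range (cylinder :: 'a::finite list \<Rightarrow> _))"
proof -
  have "sets seq_borel = sigma_sets UNIV {U :: (nat \<Rightarrow> 'a) set. openin seq_topology U}"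
    by (simp add: seq_borel_def)
  also have "\<dots> = sigma_sets UNIV (range cylinder)"
  proof (intro sigma_sets_eqI)
    fix U :: "(nat \<Rightarrow> 'a) set" assume "U \<in> {U. openin seq_topology U}"
    then have "U = \<Union> (cylinder ` {w. cylinder w \<subseteq> U})"
      by (intro open_eq_Union_cylinder) simp
    moreover have "\<Union> (cylinder ` {w. cylinder w \<subseteq> U}) \<in> sigma_sets UNIV (range cylinder)"
      by (intro sigma_sets_UNION countable_image countableI_type) (blast intro: sigma_sets.Basic)
    ultimately show "U \<in> sigma_sets UNIV (range cylinder)" by (rule ssubst)
  next
    fix U :: "(nat \<Rightarrow> 'a) set" assume "U \<in> range cylinder"
    then show "U \<in> sigma_sets UNIV {U. openin seq_topology U}"
      using openin_cylinder by (blast intro: sigma_sets.Basic)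
  qed
  finally show ?thesis .
qed

lemma cylinder_in_sets [measurable, simp]: "cylinder (w :: 'a::finite list) \<in> sets seq_borel"
  unfolding sets_seq_borel by (rule sigma_sets.Basic) simp

lemma measurable_seq_borelI:
  fixes f :: "'b \<Rightarrow> nat \<Rightarrow> 'a::finite"
  assumes "\<And>w. f -` cylinder w \<inter> space M \<in> sets M"
  shows "f \<in> measurable M seq_borel"
  by (rule measurable_sigma_sets[OF sets_seq_borel]) (use assms in blast)+

lemma vimage_shift_cylinder: "shift -` cylinder w = (\<Union>b. cylinder (b # w))"
  by (auto simp: cylinder_def shift_def nth_Cons split: nat.splits)

lemma measurable_shift [measurable]: "shift \<in> measurable seq_borel (seq_borel :: (nat \<Rightarrow> 'a::finite) measure)"
  by (rule measurable_seq_borelI) (auto simp: vimage_shift_cylinder)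

lemma borel_measurable_continuous_seq:
  fixes f :: "(nat \<Rightarrow> 'a::finite) \<Rightarrow> real"
  assumes "continuous_map seq_topology euclideanreal f"
  shows "f \<in> borel_measurable seq_borel"
proof (rule borel_measurableI)
  fix S :: "real set" assume "open S"
  then have "openin seq_topology (f -` S)"
    using assms by (auto simp: continuous_map_def vimage_def)
  then show "f -` S \<inter> space seq_borel \<in> sets seq_borel"
    by (auto simp: seq_borel_def intro: sigma_sets.Basic)
qed

lemma cylinder_Int_cases: "cylinder u \<inter> cylinder w \<in> {{}, cylinder u, cylinder w}"
proof -
  have *: "cylinder u \<inter> cylinder w \<in> {{}, cylinder w}" if "length u \<le> length w" for u w :: "'a list"
  proof (cases "\<forall>i<length u. u ! i = w ! i")
    case True
    then show ?thesis using that by (auto simp: cylinder_def)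
  next
    case False
    then show ?thesis using that by (fastforce simp: cylinder_def)
  qed
  show ?thesis using *[of u w] *[of w u] by (cases "length u \<le> length w") (auto simp: Int_commute)
qed

lemma seq_measure_eqI:
  fixes M N :: "(nat \<Rightarrow> 'a::finite) measure"
  assumes "sets M = sets seq_borel" "sets N = sets seq_borel" "prob_space M" "prob_space N"
    and eq: "\<And>w. measure M (cylinder w) = measure N (cylinder w)"
  shows "M = N"
proof -
  interpret M: prob_space M by fact
  interpret N: prob_space N by fact
  have gen: "sigma_sets UNIV (insert {} (range (cylinder :: 'a list \<Rightarrow> _))) = sigma_sets UNIV (range cylinder)"
    by (intro sigma_sets_eqI) (blast intro: sigma_sets.Basic sigma_sets.Empty)+
  show ?thesis
  proof (rule measure_eqI_generator_eq)
    show "Int_stable (insert {} (range (cylinder :: 'a list \<Rightarrow> _)))"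
      unfolding Int_stable_def using cylinder_Int_cases by fastforce
    show "sets M = sigma_sets UNIV (insert {} (range cylinder))"
      "sets N = sigma_sets UNIV (insert {} (range cylinder))"
      using assms(1,2) gen by (simp_all add: sets_seq_borel)
    show "range (\<lambda>_::nat. cylinder []) \<subseteq> insert {} (range (cylinder :: 'a list \<Rightarrow> _))" by blast
    show "(\<Union>i::nat. cylinder []) = (UNIV :: (nat \<Rightarrow> 'a) set)" by simp
    show "emeasure M (cylinder []) \<noteq> \<infinity>" for i :: nat by (simp add: M.emeasure_eq_measure)
    show "emeasure M X = emeasure N X" if "X \<in> insert {} (range cylinder)" for X
      using that eq by (auto simp: M.emeasure_eq_measure N.emeasure_eq_measure)
  qed auto
qed

lemma mem_cylinder_snoc: "x \<in> cylinder (w @ [b]) \<longleftrightarrow> x \<in> cylinder w \<and> x (length w) = b"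
  by (simp add: cylinder_def nth_append less_Suc_eq all_conj_distrib imp_conjL)

lemma mem_cylinder_Cons: "x \<in> cylinder (b # w) \<longleftrightarrow> x 0 = b \<and> shift x \<in> cylinder w"
  by (auto simp: cylinder_def shift_def less_Suc_eq_0_disj)

lemma cylinder_eq_Union_snoc: "cylinder w = (\<Union>b. cylinder (w @ [b]))"
  by (auto simp: mem_cylinder_snoc)

lemma invariant_measures_stationary_family:
  fixes \<mu> :: "(nat \<Rightarrow> 'a::finite) measure"
  assumes "\<mu> \<in> invariant_measures"
  shows "stationary_family (block_prob \<mu>)"
proof -
  have s [measurable_cong, simp]: "sets \<mu> = sets seq_borel" and d: "distr \<mu> seq_borel shift = \<mu>"
    and pr: "prob_space \<mu>" using assms by (auto simp: invariant_measures_def)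
  interpret prob_space \<mu> by fact
  have sp [simp]: "space \<mu> = UNIV" using sets_eq_imp_space_eq[OF s] by simp
  show ?thesis
  proof
    fix w :: "'a list"
    show "0 \<le> block_prob \<mu> w" by (simp add: block_prob_def)
    show "block_prob \<mu> [] = 1" using prob_space by (simp add: block_prob_def)
    have "measure \<mu> (\<Union>b\<in>UNIV. cylinder (w @ [b])) = (\<Sum>b\<in>UNIV. measure \<mu> (cylinder (w @ [b])))"
      by (rule finite_measure_finite_Union)
        (auto simp: disjoint_family_on_def mem_cylinder_snoc)
    then show "(\<Sum>b\<in>UNIV. block_prob \<mu> (w @ [b])) = block_prob \<mu> w"
      by (simp add: block_prob_def flip: cylinder_eq_Union_snoc)
    have "measure \<mu> (\<Union>b\<in>UNIV. cylinder (b # w)) = (\<Sum>b\<in>UNIV. measure \<mu> (cylinder (b # w)))"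
      by (rule finite_measure_finite_Union)
        (auto simp: disjoint_family_on_def mem_cylinder_Cons)
    moreover have "measure (distr \<mu> seq_borel shift) (cylinder w) = measure \<mu> (shift -` cylinder w \<inter> space \<mu>)"
      by (rule measure_distr) auto
    ultimately show "(\<Sum>b\<in>UNIV. block_prob \<mu> (b # w)) = block_prob \<mu> w"
      by (simp add: d block_prob_def vimage_shift_cylinder)
  qed
qed

lemma invariant_measuresI:
  fixes \<mu> :: "(nat \<Rightarrow> 'a::finite) measure"
  assumes s [measurable_cong, simp]: "sets \<mu> = sets seq_borel" and "prob_space \<mu>" "stationary_family (block_prob \<mu>)"
  shows "\<mu> \<in> invariant_measures"
proof -
  interpret prob_space \<mu> by fact
  interpret stationary_family "block_prob \<mu>" by fact
  have sp [simp]: "space \<mu> = UNIV" using sets_eq_imp_space_eq[OF s] by simp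
  have [measurable]: "shift \<in> measurable \<mu> seq_borel" by measurable
  have "distr \<mu> seq_borel shift = \<mu>"
  proof (rule seq_measure_eqI)
    fix w
    have "measure \<mu> (\<Union>b\<in>UNIV. cylinder (b # w)) = (\<Sum>b\<in>UNIV. measure \<mu> (cylinder (b # w)))"
      by (rule finite_measure_finite_Union)
        (auto simp: disjoint_family_on_def mem_cylinder_Cons)
    moreover have "measure (distr \<mu> seq_borel shift) (cylinder w) = measure \<mu> (shift -` cylinder w \<inter> space \<mu>)"
      by (rule measure_distr) auto
    ultimately show "measure (distr \<mu> seq_borel shift) (cylinder w) = measure \<mu> (cylinder w)"
      using Cons[of w] by (simp add: block_prob_def vimage_shift_cylinder)
  qed (auto intro: prob_space_distr \<open>prob_space \<mu>\<close>)
  then show ?thesis using assms by (simp add: invariant_measures_def)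
qed

text \<open>
  A function \<open>\<omega>\<close> that proposes a next letter after every finite word determines a sequence, whose
  initial segments are its histories. For independent proposals this produces a process with
  prescribed conditional probabilities.
\<close>

primrec history :: "('a list \<Rightarrow> 'a) \<Rightarrow> nat \<Rightarrow> 'a list" where
  "history \<omega> 0 = []"
| "history \<omega> (Suc n) = history \<omega> n @ [\<omega> (history \<omega> n)]"

lemma length_history [simp]: "length (history \<omega> n) = n"
  by (induction n) auto

lemma history_cylinder_iff:
  "(\<lambda>n. \<omega> (history \<omega> n)) \<in> cylinder w \<longleftrightarrow> (\<forall>i<length w. \<omega> (take i w) = w ! i)"
proof -
  have 1: "history \<omega> n = take n w" if "\<forall>i<length w. \<omega> (take i w) = w ! i" "n \<le> length w" for n
    using that(2) by (induction n) (simp_all add: that(1) take_Suc_conv_app_nth)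
  have 2: "history \<omega> n = take n w" if "\<forall>i<length w. \<omega> (history \<omega> i) = w ! i" "n \<le> length w" for n
    using that(2)
  proof (induction n)
    case (Suc n)
    have "\<omega> (history \<omega> n) = w ! n" using that(1) Suc.prems by (meson Suc_le_lessD)
    then show ?case using Suc by (simp add: take_Suc_conv_app_nth)
  qed simp
  show ?thesis
    unfolding cylinder_def mem_Collect_eq
  proof
    assume *: "\<forall>i<length w. \<omega> (history \<omega> i) = w ! i"
    show "\<forall>i<length w. \<omega> (take i w) = w ! i"
    proof (intro allI impI)
      fix i assume "i < length w"
      then show "\<omega> (take i w) = w ! i" using * 2[OF *, of i] by (metis less_imp_le)
    qed
  next
    assume *: "\<forall>i<length w. \<omega> (take i w) = w ! i"
    show "\<forall>i<length w. \<omega> (history \<omega> i) = w ! i"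
    proof (intro allI impI)
      fix i assume "i < length w"
      then show "\<omega> (history \<omega> i) = w ! i" using * 1[OF *, of i] by (metis less_imp_le)
    qed
  qed
qed

text \<open>
  Let the proposals after the words \<open>v\<close> be independent with law \<open>p (v @ [b]) / p v\<close>. The generated
  sequence lies in the cylinder of \<open>w\<close> iff the proposals at the prefixes of \<open>w\<close>, which are finitely
  many distinct coordinates, are the letters of \<open>w\<close>. Hence the probability is a finite product, and
  it telescopes to \<open>p w\<close>.
\<close>

lemma (in stationary_family) invariant_measure_exists:
  assumes pos: "\<And>w. 0 < p w"
  obtains \<mu> where "\<mu> \<in> invariant_measures" "block_prob \<mu> = p"
proof -
  define q where "q v = embed_pmf (\<lambda>b. p (v @ [b]) / p v)" for v
  have q: "pmf (q v) b = p (v @ [b]) / p v" for v b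
    unfolding q_def
  proof (rule pmf_embed_pmf)
    show "(\<integral>\<^sup>+ b. ennreal (p (v @ [b]) / p v) \<partial>count_space UNIV) = 1"
      using pos[of v] snoc[of v]
      by (subst nn_integral_count_space_finite) (auto simp: nonneg sum_divide_distrib[symmetric])
  qed (simp add: nonneg)
  interpret Q: product_prob_space "\<lambda>v. measure_pmf (q v)" UNIV
    by (rule product_prob_spaceI) (rule prob_space_measure_pmf)
  define \<Omega> where "\<Omega> = PiM UNIV (\<lambda>v. measure_pmf (q v))"
  define X where "X \<omega> = (\<lambda>n. \<omega> (history \<omega> n))" for \<omega> :: "'a list \<Rightarrow> 'a"
  define J where "J w = (\<lambda>i. take i w) ` {..<length w}" for w :: "'a list"
  have sp: "space \<Omega> = UNIV" by (simp add: \<Omega>_def space_PiM)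
  have vX: "X -` cylinder w \<inter> space \<Omega> = prod_emb UNIV (\<lambda>v. measure_pmf (q v)) (J w) (PiE (J w) (\<lambda>v. {w ! length v}))" for w
    by (rule set_eqI) (auto simp: sp X_def history_cylinder_iff prod_emb_def J_def restrict_PiE_iff Pi_iff)
  have inj: "inj_on (\<lambda>i. take i w) {..<length w}" for w :: "'a list"
    by (rule inj_onI) (metis length_take lessThan_iff min.absorb4)
  have telescope: "(\<Prod>i<n. p (take i w @ [w ! i]) / p (take i w)) = p (take n w)" if "n \<le> length w" for n w
    using that
  proof (induction n)
    case (Suc n)
    then show ?case using pos[of "take n w"] by (simp add: take_Suc_conv_app_nth)
  qed (simp add: Nil)
  have em: "emeasure \<Omega> (X -` cylinder w \<inter> space \<Omega>) = ennreal (p w)" for w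
  proof -
    have "emeasure \<Omega> (X -` cylinder w \<inter> space \<Omega>) = (\<Prod>v\<in>J w. emeasure (measure_pmf (q v)) {w ! length v})"
      unfolding vX unfolding \<Omega>_def by (rule Q.emeasure_PiM_emb) (auto simp: J_def)
    also have "\<dots> = (\<Prod>i<length w. ennreal (p (take i w @ [w ! i]) / p (take i w)))"
      unfolding J_def by (subst prod.reindex[OF inj]) (auto simp: emeasure_pmf_single q intro!: prod.cong)
    also have "\<dots> = ennreal (p w)"
      using telescope[of "length w" w] by (subst prod_ennreal) (auto simp: nonneg)
    finally show ?thesis .
  qed
  have X [measurable]: "X \<in> measurable \<Omega> seq_borel"
  proof (rule measurable_seq_borelI)
    fix w show "X -` cylinder w \<inter> space \<Omega> \<in> sets \<Omega>"
      unfolding vX unfolding \<Omega>_def by (rule sets_PiM_I) (auto simp: J_def)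
  qed
  define \<mu> where "\<mu> = distr \<Omega> seq_borel X"
  have P: "prob_space \<Omega>" unfolding \<Omega>_def by (rule prob_space_PiM) (rule prob_space_measure_pmf)
  have b: "block_prob \<mu> = p"
    by (rule ext) (simp add: block_prob_def \<mu>_def measure_def emeasure_distr em nonneg)
  moreover have "\<mu> \<in> invariant_measures"
  proof (rule invariant_measuresI)
    show "stationary_family (block_prob \<mu>)" unfolding b by (rule stationary_family_axioms)
    show "prob_space \<mu>" unfolding \<mu>_def by (rule prob_space.prob_space_distr[OF P X])
  qed (simp add: \<mu>_def)
  ultimately show thesis by (rule that[rotated])
qed

section \<open>Variation of continuous potentials\<close>

lemma compact_space_seq_topology: "compact_space (seq_topology :: (nat \<Rightarrow> 'a::finite) topology)"
  unfolding seq_topology_def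
  by (simp add: compact_space_product_topology compact_space_discrete_topology)

definition variation :: "((nat \<Rightarrow> 'a) \<Rightarrow> real) \<Rightarrow> nat \<Rightarrow> real" where
  "variation \<phi> k = Sup {\<bar>\<phi> x - \<phi> y\<bar> | x y. \<forall>i<k. x i = y i}"

context
  fixes \<phi> :: "(nat \<Rightarrow> 'a::finite) \<Rightarrow> real"
  assumes cont: "continuous_map seq_topology euclideanreal \<phi>"
begin

lemma continuous_seq_bounded: obtains B where "0 < B" "\<And>x. \<bar>\<phi> x\<bar> \<le> B"
proof -
  have "compactin euclideanreal (\<phi> ` UNIV)"
    using compact_space_seq_topology cont unfolding compact_space_def
    by (metis image_compactin topspace_seq_topology)
  then have "bounded (range \<phi>)" by (simp add: compact_imp_bounded)
  then show thesis using that by (auto simp: bounded_pos)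
qed

lemma variation_le: assumes "\<forall>i<k. x i = y i" shows "\<bar>\<phi> x - \<phi> y\<bar> \<le> variation \<phi> k"
proof -
  obtain B where B: "\<And>x. \<bar>\<phi> x\<bar> \<le> B" using continuous_seq_bounded by blast
  have "bdd_above {\<bar>\<phi> x - \<phi> y\<bar> | x y. \<forall>i<k. x i = y i}"
  proof (rule bdd_aboveI[of _ "2 * B"])
    fix r assume "r \<in> {\<bar>\<phi> x - \<phi> y\<bar> | x y. \<forall>i<k. x i = y i}"
    then obtain x y where "r = \<bar>\<phi> x - \<phi> y\<bar>" by blast
    then show "r \<le> 2 * B" using B[of x] B[of y] by linarith
  qed
  then show ?thesis unfolding variation_def by (rule cSup_upper[rotated]) (use assms in blast)
qed

lemma variation_nonneg: "0 \<le> variation \<phi> k"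
  using variation_le[of k undefined undefined] by simp

text \<open>
  Uniform continuity: cylinders on which \<open>\<phi>\<close> is nearly constant cover the compact sequence space,
  and a finite subcover only involves coordinates below some bound.
\<close>

lemma variation_tendsto_0: "variation \<phi> \<longlonglongrightarrow> 0"
proof (rule LIMSEQ_I)
  fix e :: real assume e: "0 < e"
  define U where "U x = {y. \<bar>\<phi> y - \<phi> x\<bar> < e / 4}" for x
  have "openin seq_topology (U x)" for x
  proof -
    have "U x = {y \<in> topspace seq_topology. \<phi> y \<in> ball (\<phi> x) (e / 4)}"
      by (auto simp: U_def dist_real_def abs_minus_commute)
    then show ?thesis
      using openin_continuous_map_preimage[OF cont, of "ball (\<phi> x) (e / 4)"] by simp
  qed
  moreover have "x \<in> U x" for x using e by (simp add: U_def)
  ultimately have "\<exists>k. cylinder (window x 0 k) \<subseteq> U x" for x by (meson cylinder_nhd)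
  then obtain K where K: "\<And>x. cylinder (window x 0 (K x)) \<subseteq> U x" by metis
  have "\<exists>F. finite F \<and> F \<subseteq> range (\<lambda>x. cylinder (window x 0 (K x))) \<and> topspace seq_topology \<subseteq> \<Union>F"
  proof (rule compactinD)
    show "compactin seq_topology (topspace seq_topology :: (nat \<Rightarrow> 'a) set)"
      using compact_space_seq_topology unfolding compact_space_def .
    show "topspace seq_topology \<subseteq> \<Union> (range (\<lambda>x. cylinder (window x 0 (K x))))"
      using mem_cylinder_window by blast
    fix V :: "(nat \<Rightarrow> 'a) set" assume "V \<in> range (\<lambda>x. cylinder (window x 0 (K x)))"
    then show "openin seq_topology V" using openin_cylinder by blast
  qed
  then obtain F where F: "finite F" "F \<subseteq> range (\<lambda>x. cylinder (window x 0 (K x)))" "UNIV \<subseteq> \<Union>F"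
    by auto
  obtain T where T: "finite T" "F = (\<lambda>x. cylinder (window x 0 (K x))) ` T"
    using finite_subset_image[OF F(1,2)] by blast
  define N where "N = (\<Sum>x\<in>T. K x)"
  have "variation \<phi> n \<le> e / 2" if "N \<le> n" for n
    unfolding variation_def
  proof (rule cSup_least)
    fix r assume "r \<in> {\<bar>\<phi> x - \<phi> y\<bar> | x y. \<forall>i<n. x i = y i}"
    then obtain x y where r: "r = \<bar>\<phi> x - \<phi> y\<bar>" and xy: "\<forall>i<n. x i = y i" by blast
    obtain t where t: "t \<in> T" "x \<in> cylinder (window t 0 (K t))" using F(3) T(2) by blast
    have "K t \<le> n" using member_le_sum[of t T K] t T that by (simp add: N_def)
    then have "y \<in> cylinder (window t 0 (K t))" using t(2) xy by (simp add: cylinder_window)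
    then have "x \<in> U t" "y \<in> U t" using K t(2) by blast+
    then show "r \<le> e / 2" unfolding U_def r mem_Collect_eq by linarith
  qed auto
  then show "\<exists>N. \<forall>n\<ge>N. norm (variation \<phi> n - 0) < e"
    using variation_nonneg e by (intro exI[of _ N]) force
qed

end

section \<open>Stationary laws with transition probabilities g\<close>

text \<open>
  The Ruelle operator of \<open>ln g\<close>: the average of \<open>f\<close> over the preimages of a point under the shift,
  with the weights \<open>g\<close>.
\<close>

definition transfer :: "((nat \<Rightarrow> 'a::finite) \<Rightarrow> real) \<Rightarrow> ((nat \<Rightarrow> 'a) \<Rightarrow> real) \<Rightarrow> (nat \<Rightarrow> 'a) \<Rightarrow> real" where
  "transfer g f = (\<lambda>y. \<Sum>b\<in>UNIV. g (case_nat b y) * f (case_nat b y))"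

lemma shift_case_nat [simp]: "shift (case_nat b y) = y"
  by (simp add: shift_def)

lemma case_nat_shift [simp]: "case_nat (x 0) (shift x) = x"
  by (auto simp: shift_def fun_eq_iff split: nat.splits)

text \<open>
  The quotient \<open>p (b # w) / p w\<close>, the probability of the letter \<open>b\<close> given that \<open>w\<close> follows, lies
  between the infimum and the supremum of \<open>g\<close> on the cylinder of \<open>b # w\<close>. This is the statement
  that \<open>g\<close> is the conditional probability of the first letter given all later ones, expressed by
  finite words.
\<close>

locale g_family = stationary_family p for p :: "'a::finite list \<Rightarrow> real" +
  fixes g :: "(nat \<Rightarrow> 'a) \<Rightarrow> real"
  assumes g_function: "g_function g"
    and lower: "(\<And>x. x \<in> cylinder (b # w) \<Longrightarrow> m \<le> g x) \<Longrightarrow> m * p w \<le> p (b # w)"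
    and upper: "(\<And>x. x \<in> cylinder (b # w) \<Longrightarrow> g x \<le> m) \<Longrightarrow> p (b # w) \<le> m * p w"

lemma g_function_pos: "g_function g \<Longrightarrow> 0 < g x"
  by (simp add: g_function_def)

lemma g_function_sum:
  fixes g :: "(nat \<Rightarrow> 'a::finite) \<Rightarrow> real"
  assumes "g_function g" shows "(\<Sum>b\<in>UNIV. g (case_nat b y)) = 1"
proof -
  have "{x. shift x = y} = range (\<lambda>b. case_nat b y)"
    by (auto simp: image_iff) (metis case_nat_shift)
  moreover have "inj (\<lambda>b. case_nat b y)" by (rule injI) (metis nat.case(1))
  ultimately have "(\<Sum>x\<in>{x. shift x = y}. g x) = (\<Sum>b\<in>UNIV. g (case_nat b y))"
    by (simp add: sum.reindex)
  then show ?thesis using assms by (simp add: g_function_def)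
qed

lemma g_function_card_ge_2:
  assumes "g_function (g :: (nat \<Rightarrow> 'a::finite) \<Rightarrow> real)" shows "2 \<le> CARD('a)"
proof (rule ccontr)
  assume "\<not> 2 \<le> CARD('a)"
  moreover have "CARD('a) \<noteq> 0" by simp
  ultimately have "CARD('a) = 1" by linarith
  then obtain b where b: "(UNIV :: 'a set) = {b}" by (rule card_1_singletonE)
  have "g (case_nat b undefined) = 1" using g_function_sum[OF assms, of undefined] unfolding b by simp
  then show False using assms unfolding g_function_def by (metis less_irrefl)
qed

lemma g_function_ln_cont:
  assumes "g_function g" shows "continuous_map seq_topology euclideanreal (\<lambda>x. ln (g x))"
proof -
  have "continuous_map seq_topology (top_of_set {0<..}) g"
    using assms by (auto simp: g_function_def continuous_map_in_subtopology)
  moreover have "continuous_map (top_of_set {0<..}) euclideanreal (ln :: real \<Rightarrow> real)"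
    by (auto intro!: continuous_intros)
  ultimately show ?thesis using continuous_map_compose[unfolded o_def] by blast
qed

context g_family
begin

abbreviation \<phi> where "\<phi> \<equiv> \<lambda>x. ln (g x)"

lemma pos: "0 < p w"
proof (induction w)
  case (Cons b w)
  obtain B where B: "\<And>x. \<bar>\<phi> x\<bar> \<le> B" using continuous_seq_bounded[OF g_function_ln_cont[OF g_function]] by blast
  have "exp (- B) \<le> g x" for x
    using B[of x] g_function_pos[OF g_function, of x] by (subst ln_ge_iff[symmetric]) auto
  then have "exp (- B) * p w \<le> p (b # w)" by (intro lower)
  moreover have "0 < exp (- B) * p w" using Cons by simp
  ultimately show ?case by linarith
qed (simp add: Nil)

lemma ln_ratio:
  assumes "x \<in> cylinder (b # w)"
  shows "\<bar>ln (p (b # w)) - ln (p w) - \<phi> x\<bar> \<le> variation \<phi> (Suc (length w))"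
proof -
  let ?v = "variation \<phi> (Suc (length w))"
  have near: "\<bar>\<phi> y - \<phi> x\<bar> \<le> ?v" if "y \<in> cylinder (b # w)" for y
    using that assms by (intro variation_le[OF g_function_ln_cont[OF g_function]]) (simp add: cylinder_def)
  have "exp (\<phi> x - ?v) * p w \<le> p (b # w)"
  proof (rule lower)
    fix y assume "y \<in> cylinder (b # w)"
    then have "\<phi> x - ?v \<le> \<phi> y" using near by fastforce
    then show "exp (\<phi> x - ?v) \<le> g y" using g_function_pos[OF g_function, of y] by (simp add: ln_ge_iff)
  qed
  then have "ln (exp (\<phi> x - ?v) * p w) \<le> ln (p (b # w))" using pos by simp
  then have 1: "\<phi> x - ?v + ln (p w) \<le> ln (p (b # w))" using pos[of w] by (simp add: ln_mult)
  have "p (b # w) \<le> exp (\<phi> x + ?v) * p w"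
  proof (rule upper)
    fix y assume "y \<in> cylinder (b # w)"
    then have "\<phi> y \<le> \<phi> x + ?v" using near by fastforce
    then show "g y \<le> exp (\<phi> x + ?v)" using g_function_pos[OF g_function, of y]
      by (metis exp_le_cancel_iff exp_ln)
  qed
  then have "ln (p (b # w)) \<le> ln (exp (\<phi> x + ?v) * p w)" using pos by simp
  then have "ln (p (b # w)) \<le> \<phi> x + ?v + ln (p w)" using pos[of w] by (simp add: ln_mult)
  with 1 show ?thesis by linarith
qed

lemma ln_ratio_window:
  "\<bar>ln (p (window x i (Suc k))) - ln (p (window x (Suc i) k)) - \<phi> ((shift ^^ i) x)\<bar> \<le> variation \<phi> (Suc k)"
  using ln_ratio[of "(shift ^^ i) x" "x i" "window x (Suc i) k"]
  by (simp add: window_Suc[symmetric] window_funpow_shift cylinder_eq_window)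

text \<open>
  Adding up the logarithms of the conditional probabilities along a word compares its probability
  with a Birkhoff sum of \<open>\<phi>\<close>. The error is \<open>o(n)\<close> uniformly, since it is a sum of variations that
  tend to 0.
\<close>

lemma ln_window:
  "\<bar>ln (p (window x i n)) - (\<Sum>j<n. \<phi> ((shift ^^ (i + j)) x))\<bar> \<le> (\<Sum>j<n. variation \<phi> (Suc j))"
proof (induction n arbitrary: i)
  case (Suc n)
  have "(\<Sum>j<Suc n. \<phi> ((shift ^^ (i + j)) x)) = \<phi> ((shift ^^ i) x) + (\<Sum>j<n. \<phi> ((shift ^^ (Suc i + j)) x))"
    by (subst sum.lessThan_Suc_shift) simp
  then show ?case using Suc[of "Suc i"] ln_ratio_window[of x i n] by (simp del: funpow.simps sum.lessThan_Suc add: sum.lessThan_Suc[where n=n and g="\<lambda>j. variation \<phi> (Suc j)"])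
qed (simp add: Nil)

end

section \<open>Existence by averaging the transfer operator\<close>

text \<open>
  Tychonoff's theorem, in sequential form because the index set is countable.
\<close>

lemma pointwise_limit_subsequence:
  fixes P :: "nat \<Rightarrow> 'b::countable \<Rightarrow> real"
  assumes "\<And>n w. P n w \<in> {0..1}"
  shows "\<exists>r p. strict_mono (r :: nat \<Rightarrow> nat) \<and> (\<forall>w. (\<lambda>n. P (r n) w) \<longlonglongrightarrow> p w)"
proof -
  have "compactin (product_topology (\<lambda>_::'b. euclideanreal) UNIV) (PiE UNIV (\<lambda>_. {0..1}))"
    by (simp add: compactin_PiE)
  then have "compact (PiE UNIV (\<lambda>_::'b. {0..1::real}))"
    by (simp only: euclidean_product_topology compactin_euclidean_iff)
  then have "seq_compact (PiE UNIV (\<lambda>_::'b. {0..1::real}))"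
    by (rule compact_imp_seq_compact)
  moreover have "\<forall>n. P n \<in> PiE UNIV (\<lambda>_. {0..1})" using assms by auto
  ultimately obtain p r where r: "strict_mono r" "(P \<circ> r) \<longlonglongrightarrow> p"
    by (rule seq_compactE)
  have "(\<lambda>n. P (r n) w) \<longlonglongrightarrow> p w" for w
    using continuous_on_tendsto_compose[OF continuous_on_product_coordinates[of w] r(2)] by simp
  with r(1) show ?thesis by blast
qed

lemma transfer_sum: "transfer g (\<lambda>y. \<Sum>b\<in>B. f b y) = (\<lambda>y. \<Sum>b\<in>B. transfer g (f b) y)"
  by (rule ext) (simp add: transfer_def sum_distrib_left sum.swap[of _ B])

lemma transfer_funpow_sum:
  "(transfer g ^^ i) (\<lambda>y. \<Sum>b\<in>B. f b y) = (\<lambda>y. \<Sum>b\<in>B. (transfer g ^^ i) (f b) y)"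
  by (induction i) (simp_all add: transfer_sum)

lemma transfer_funpow_scale: "(transfer g ^^ i) (\<lambda>y. m * f y) = (\<lambda>y. m * (transfer g ^^ i) f y)"
proof (induction i)
  case (Suc i)
  then show ?case by (auto simp: transfer_def fun_eq_iff sum_distrib_left mult_ac)
qed simp

lemma transfer_funpow_mono:
  fixes g :: "(nat \<Rightarrow> 'a::finite) \<Rightarrow> real"
  assumes "g_function g" "\<And>y. f y \<le> h y"
  shows "(transfer g ^^ i) f y \<le> (transfer g ^^ i) h y"
proof (induction i arbitrary: y)
  case (Suc i)
  then show ?case
    by (auto simp: transfer_def intro!: sum_mono mult_left_mono less_imp_le[OF g_function_pos[OF assms(1)]])
qed (simp add: assms)

text \<open>
  Since the weights of the preimages add up to 1, the operator is a left inverse of composition with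
  the shift. This is the source of shift invariance in the limit below.
\<close>

lemma transfer_compose_shift:
  fixes g :: "(nat \<Rightarrow> 'a::finite) \<Rightarrow> real"
  assumes "g_function g" shows "transfer g (\<lambda>y. f (shift y)) = f"
  using g_function_sum[OF assms] by (simp add: transfer_def flip: sum_distrib_right)

lemma transfer_funpow_const:
  fixes g :: "(nat \<Rightarrow> 'a::finite) \<Rightarrow> real"
  assumes "g_function g" shows "(transfer g ^^ i) (\<lambda>_. m) = (\<lambda>_. m)"
  by (induction i) (use transfer_compose_shift[OF assms, of "\<lambda>_. m"] in simp_all)

abbreviation cyl_ind :: "'a list \<Rightarrow> (nat \<Rightarrow> 'a) \<Rightarrow> real" where
  "cyl_ind w \<equiv> indicator (cylinder w)"

lemma transfer_cyl_ind_Cons: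
  fixes g :: "(nat \<Rightarrow> 'a::finite) \<Rightarrow> real"
  shows "transfer g (cyl_ind (b # w)) = (\<lambda>y. g (case_nat b y) * cyl_ind w y)"
proof
  fix y
  have "transfer g (cyl_ind (b # w)) y = (\<Sum>a\<in>UNIV. if a = b then g (case_nat b y) * cyl_ind w y else 0)"
    unfolding transfer_def by (intro sum.cong) (auto simp: indicator_def mem_cylinder_Cons)
  then show "transfer g (cyl_ind (b # w)) y = g (case_nat b y) * cyl_ind w y" by simp
qed

lemma cyl_ind_snoc: "(\<lambda>y. \<Sum>b\<in>(UNIV::'a::finite set). cyl_ind (w @ [b]) y) = cyl_ind w"
proof
  fix y
  have "(\<Sum>b\<in>UNIV. cyl_ind (w @ [b]) y) = (\<Sum>b\<in>UNIV. if b = y (length w) then cyl_ind w y else 0)"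
    by (intro sum.cong) (auto simp: indicator_def mem_cylinder_snoc)
  then show "(\<Sum>b\<in>UNIV. cyl_ind (w @ [b]) y) = cyl_ind w y" by simp
qed

lemma cyl_ind_Cons: "(\<lambda>y. \<Sum>b\<in>(UNIV::'a::finite set). cyl_ind (b # w) y) = (\<lambda>y. cyl_ind w (shift y))"
proof
  fix y
  have "(\<Sum>b\<in>UNIV. cyl_ind (b # w) y) = (\<Sum>b\<in>UNIV. if b = y 0 then cyl_ind w (shift y) else 0)"
    by (intro sum.cong) (auto simp: indicator_def mem_cylinder_Cons)
  then show "(\<Sum>b\<in>UNIV. cyl_ind (b # w) y) = cyl_ind w (shift y)" by simp
qed

text \<open>
  Start at a point \<open>c\<close> and prepend letters at random according to \<open>g\<close>. After \<open>i\<close> steps the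
  probability of starting with \<open>w\<close> is \<open>a i w\<close>, and one more step multiplies it by a value of \<open>g\<close>.
  Averaging over \<open>i\<close> makes the law stationary up to \<open>O(1 / n)\<close>, and a limit point of the averages
  has all the required properties.
\<close>

lemma g_family_exists:
  fixes g :: "(nat \<Rightarrow> 'a::finite) \<Rightarrow> real"
  assumes g: "g_function g"
  obtains p where "g_family p g"
proof -
  define c :: "nat \<Rightarrow> 'a" where "c = undefined"
  define a where "a i w = (transfer g ^^ i) (cyl_ind w) c" for i w
  define P where "P n w = (\<Sum>i<Suc n. a i w) / real (Suc n)" for n w
  \<comment> \<open>The same average one step later. It has the same limit, while the relations with \<open>P\<close> are exact.\<close>
  define P' where "P' n w = (\<Sum>i<Suc n. a (Suc i) w) / real (Suc n)" for n w
  have a0: "0 \<le> a i w" for i w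
    unfolding a_def using transfer_funpow_mono[OF g, of "\<lambda>_. 0" "cyl_ind w" i c]
    by (simp add: transfer_funpow_const[OF g])
  have a1: "a i w \<le> 1" for i w
    unfolding a_def using transfer_funpow_mono[OF g, of "cyl_ind w" "\<lambda>_. 1" i c]
    by (simp add: transfer_funpow_const[OF g] indicator_def)
  have P01: "P n w \<in> {0..1}" for n w
  proof -
    have "(\<Sum>i<Suc n. a i w) \<le> (\<Sum>i<Suc n. 1)" by (intro sum_mono a1)
    moreover have "0 \<le> (\<Sum>i<Suc n. a i w)" by (intro sum_nonneg a0)
    ultimately show ?thesis by (simp add: P_def field_simps)
  qed
  obtain r p where r: "strict_mono (r :: nat \<Rightarrow> nat)" and p: "\<And>w. (\<lambda>n. P (r n) w) \<longlonglongrightarrow> p w"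
    using pointwise_limit_subsequence[of P, OF P01] by auto
  have diff: "\<bar>P' n w - P n w\<bar> \<le> 1 / real (Suc n)" for n w
  proof -
    have "(\<Sum>i<Suc n. a (Suc i) w) - (\<Sum>i<Suc n. a i w) = a (Suc n) w - a 0 w"
      using sum_lessThan_telescope[of "\<lambda>i. a i w" "Suc n"] by (simp only: sum_subtractf)
    then have "P' n w - P n w = (a (Suc n) w - a 0 w) / real (Suc n)"
      by (simp only: P_def P'_def flip: diff_divide_distrib)
    moreover have "\<bar>a (Suc n) w - a 0 w\<bar> \<le> 1"
      using a0[of "Suc n" w] a0[of 0 w] a1[of "Suc n" w] a1[of 0 w] by linarith
    ultimately show ?thesis by (simp add: abs_divide divide_right_mono del: of_nat_Suc)
  qed
  have p': "(\<lambda>n. P' (r n) w) \<longlonglongrightarrow> p w" for w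
  proof -
    have "(\<lambda>n. 1 / real (Suc (r n))) \<longlonglongrightarrow> 0"
      using LIMSEQ_subseq_LIMSEQ[OF LIMSEQ_inverse_real_of_nat r] by (simp add: o_def inverse_eq_divide)
    then have "(\<lambda>n. P' (r n) w - P (r n) w) \<longlonglongrightarrow> 0"
      by (rule Lim_null_comparison[rotated]) (use diff in simp)
    from tendsto_add[OF this p[of w]] show ?thesis by simp
  qed
  have aS: "a (Suc i) (b # w) = (transfer g ^^ i) (\<lambda>y. g (case_nat b y) * cyl_ind w y) c" for i b w
    by (simp only: a_def funpow_Suc_right o_apply transfer_cyl_ind_Cons)
  have ma: "m * a i w = (transfer g ^^ i) (\<lambda>y. m * cyl_ind w y) c" for m i w
    by (simp only: a_def transfer_funpow_scale)
  have bounds: "m * P n w \<le> P' n (b # w)" if "\<And>x. x \<in> cylinder (b # w) \<Longrightarrow> m \<le> g x" for m n w b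
  proof -
    have "m * a i w \<le> a (Suc i) (b # w)" for i
      unfolding aS ma
      by (rule transfer_funpow_mono[OF g]) (use that in \<open>auto simp: indicator_def mem_cylinder_Cons\<close>)
    then have "(\<Sum>i<Suc n. m * a i w) \<le> (\<Sum>i<Suc n. a (Suc i) (b # w))" by (intro sum_mono)
    then show ?thesis
      unfolding P_def P'_def times_divide_eq_right sum_distrib_left by (intro divide_right_mono) auto
  qed
  have bounds': "P' n (b # w) \<le> m * P n w" if "\<And>x. x \<in> cylinder (b # w) \<Longrightarrow> g x \<le> m" for m n w b
  proof -
    have "a (Suc i) (b # w) \<le> m * a i w" for i
      unfolding aS ma
      by (rule transfer_funpow_mono[OF g]) (use that in \<open>auto simp: indicator_def mem_cylinder_Cons\<close>)
    then have "(\<Sum>i<Suc n. a (Suc i) (b # w)) \<le> (\<Sum>i<Suc n. m * a i w)" by (intro sum_mono)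
    then show ?thesis
      unfolding P_def P'_def times_divide_eq_right sum_distrib_left by (intro divide_right_mono) auto
  qed
  have "g_family p g"
  proof
    fix w :: "'a list" and b m
    show "0 \<le> p w" using p[of w] P01 by (intro LIMSEQ_le_const) auto
    have "P n [] = 1" for n
    proof -
      have "cyl_ind [] = (\<lambda>_::nat \<Rightarrow> 'a. 1)" by (simp add: fun_eq_iff)
      then have "a i [] = 1" for i using transfer_funpow_const[OF g, of i 1] by (simp only: a_def)
      then show ?thesis by (simp add: P_def)
    qed
    then show "p [] = 1" using p[of "[]"] by (simp add: LIMSEQ_const_iff)
    have "(\<Sum>b\<in>UNIV. a i (w @ [b])) = a i w" for i
      using fun_cong[OF transfer_funpow_sum[of i g "\<lambda>b. cyl_ind (w @ [b])" UNIV], of c]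
      by (simp only: a_def cyl_ind_snoc)
    then have "(\<Sum>b\<in>UNIV. P n (w @ [b])) = P n w" for n
      unfolding P_def sum_divide_distrib[symmetric] by (subst sum.swap) simp
    then have "(\<lambda>n. P (r n) w) \<longlonglongrightarrow> (\<Sum>b\<in>UNIV. p (w @ [b]))"
      using tendsto_sum[of UNIV "\<lambda>b n. P (r n) (w @ [b])" "\<lambda>b. p (w @ [b])" sequentially] p by simp
    then show "(\<Sum>b\<in>UNIV. p (w @ [b])) = p w" using p LIMSEQ_unique by blast
    have "(\<Sum>b\<in>UNIV. a (Suc i) (b # w)) = a i w" for i
      using fun_cong[OF transfer_funpow_sum[of "Suc i" g "\<lambda>b. cyl_ind (b # w)" UNIV], of c]
      by (simp only: a_def cyl_ind_Cons funpow_Suc_right o_apply transfer_compose_shift[OF g])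
    then have "(\<Sum>b\<in>UNIV. P' n (b # w)) = P n w" for n
      unfolding P_def P'_def sum_divide_distrib[symmetric] by (subst sum.swap) simp
    then have "(\<lambda>n. P (r n) w) \<longlonglongrightarrow> (\<Sum>b\<in>UNIV. p (b # w))"
      using tendsto_sum[of UNIV "\<lambda>b n. P' (r n) (b # w)" "\<lambda>b. p (b # w)" sequentially] p' by simp
    then show "(\<Sum>b\<in>UNIV. p (b # w)) = p w" using p LIMSEQ_unique by blast
    show "m * p w \<le> p (b # w)" if "\<And>x. x \<in> cylinder (b # w) \<Longrightarrow> m \<le> g x"
      by (rule LIMSEQ_le[OF tendsto_mult[OF tendsto_const p] p']) (use bounds[OF that] in auto)
    show "p (b # w) \<le> m * p w" if "\<And>x. x \<in> cylinder (b # w) \<Longrightarrow> g x \<le> m"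
      by (rule LIMSEQ_le[OF p' tendsto_mult[OF tendsto_const p]]) (use bounds'[OF that] in auto)
  qed (rule g)
  then show thesis by (rule that)
qed

section \<open>Entropy rates\<close>

lemma cesaro_tendsto_0:
  fixes a :: "nat \<Rightarrow> real"
  assumes a: "a \<longlonglongrightarrow> 0"
  shows "(\<lambda>n. (\<Sum>j<n. a j) / real n) \<longlonglongrightarrow> 0"
proof (rule LIMSEQ_I)
  fix e :: real assume e: "0 < e"
  obtain N where N: "\<And>j. N \<le> j \<Longrightarrow> \<bar>a j\<bar> < e / 2"
    using LIMSEQ_D[OF a, of "e / 2"] e by auto
  define S where "S = (\<Sum>j<N. \<bar>a j\<bar>)"
  have S: "0 \<le> S" unfolding S_def by (intro sum_nonneg) auto
  have main: "\<bar>\<Sum>j<n. a j\<bar> \<le> S + real n * (e / 2)" for n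
  proof -
    have "\<bar>\<Sum>j<n. a j\<bar> \<le> (\<Sum>j<n. \<bar>a j\<bar>)" by (rule sum_abs)
    also have "\<dots> \<le> (\<Sum>j<n. (if j < N then \<bar>a j\<bar> else 0) + e / 2)"
    proof (rule sum_mono)
      fix j
      show "\<bar>a j\<bar> \<le> (if j < N then \<bar>a j\<bar> else 0) + e / 2"
        using N[of j] e by (cases "j < N") auto
    qed
    also have "\<dots> = (\<Sum>j\<in>{..<n} \<inter> {..<N}. \<bar>a j\<bar>) + real n * (e / 2)"
      by (simp add: sum.distrib sum.inter_restrict)
    also have "(\<Sum>j\<in>{..<n} \<inter> {..<N}. \<bar>a j\<bar>) \<le> S"
      unfolding S_def by (intro sum_mono2) auto
    finally show ?thesis by simp
  qed
  obtain M where M: "2 * S / e < real M" using reals_Archimedean2 by blast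
  have "\<bar>(\<Sum>j<n. a j) / real n\<bar> < e" if "Suc M \<le> n" for n
  proof -
    have "2 * S / e < real n" using M that by linarith
    then have "2 * S < real n * e" using e by (simp add: divide_less_eq)
    then have "S + real n * (e / 2) < e * real n" by (simp add: field_simps)
    with main[of n] have "\<bar>\<Sum>j<n. a j\<bar> < e * real n" by linarith
    then show ?thesis using that by (simp add: abs_divide divide_less_eq)
  qed
  then show "\<exists>no. \<forall>n\<ge>no. norm ((\<Sum>j<n. a j) / real n - 0) < e" by auto
qed

lemma cesaro:
  fixes a :: "nat \<Rightarrow> real"
  assumes "a \<longlonglongrightarrow> l"
  shows "(\<lambda>n. (\<Sum>j<n. a j) / real n) \<longlonglongrightarrow> l"
proof -
  have "(\<lambda>n. (\<Sum>j<n. a j - l) / real n) \<longlonglongrightarrow> 0"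
    using assms by (intro cesaro_tendsto_0) (simp add: LIM_zero_iff)
  then have "(\<lambda>n. (\<Sum>j<n. a j - l) / real n + l) \<longlonglongrightarrow> l"
    using tendsto_add[OF _ tendsto_const, of _ 0 sequentially l] by simp
  moreover have "\<forall>\<^sub>F n in sequentially. (\<Sum>j<n. a j - l) / real n + l = (\<Sum>j<n. a j) / real n"
    using eventually_gt_at_top[of 0] by eventually_elim (simp add: sum_subtractf field_simps)
  ultimately show ?thesis by (rule Lim_transform_eventually)
qed

lemma block_entropy_eq: "block_entropy n \<mu> = word_entropy (block_prob \<mu>) n"
  by (simp add: block_entropy_def word_entropy_def)

lemma measure_entropy_eqI:
  fixes \<mu> :: "(nat \<Rightarrow> 'a::finite) measure"
  assumes "\<mu> \<in> invariant_measures" and "cond_entropy (block_prob \<mu>) \<longlonglongrightarrow> c"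
  shows "measure_entropy \<mu> = c"
proof -
  interpret stationary_family "block_prob \<mu>" by (rule invariant_measures_stationary_family) fact
  show ?thesis
    unfolding measure_entropy_def block_entropy_eq word_entropy_eq_sum
    by (intro limI cesaro assms)
qed

text \<open>
  The entropy rate is the limit of the decreasing conditional entropies.
\<close>

lemma measure_entropy_le_cond_entropy:
  fixes \<mu> :: "(nat \<Rightarrow> 'a::finite) measure"
  assumes "\<mu> \<in> invariant_measures"
  shows "measure_entropy \<mu> \<le> cond_entropy (block_prob \<mu>) k"
proof -
  interpret stationary_family "block_prob \<mu>" by (rule invariant_measures_stationary_family) fact
  obtain L where "cond_entropy (block_prob \<mu>) \<longlonglongrightarrow> L" "\<forall>i. L \<le> cond_entropy (block_prob \<mu>) i"
    using decseq_convergent[OF decseq_cond_entropy, of 0] cond_entropy_nonneg by blast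
  then show ?thesis using measure_entropy_eqI[OF assms] by simp
qed

lemma integrable_continuous_seq:
  fixes \<phi> :: "(nat \<Rightarrow> 'a::finite) \<Rightarrow> real"
  assumes cont: "continuous_map seq_topology euclideanreal \<phi>"
    and "sets \<mu> = sets seq_borel" "prob_space \<mu>"
  shows "integrable \<mu> \<phi>"
proof -
  interpret prob_space \<mu> by fact
  obtain B where B: "\<And>x. \<bar>\<phi> x\<bar> \<le> B" using continuous_seq_bounded[OF cont] by auto
  show ?thesis
    using B borel_measurable_continuous_seq[OF cont] measurable_cong_sets[OF assms(2) refl, of borel]
    by (intro integrable_const_bound[of _ B]) auto
qed

lemma integral_cylinder_approx:
  fixes \<phi> :: "(nat \<Rightarrow> 'a::finite) \<Rightarrow> real"
  assumes cont: "continuous_map seq_topology euclideanreal \<phi>"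
    and s: "sets \<mu> = sets seq_borel" and pr: "prob_space \<mu>"
    and f: "\<And>w x. w \<in> strings k \<Longrightarrow> x \<in> cylinder w \<Longrightarrow> \<bar>\<phi> x - f w\<bar> \<le> e"
  shows "\<bar>(\<integral>x. \<phi> x \<partial>\<mu>) - (\<Sum>w\<in>strings k. block_prob \<mu> w * f w)\<bar> \<le> e"
proof -
  interpret prob_space \<mu> by fact
  define F where "F x = (\<Sum>w\<in>strings k. f w * indicator (cylinder w) x)" for x :: "nat \<Rightarrow> 'a"
  have F: "F x = f (window x 0 k)" for x
  proof -
    have "F x = (\<Sum>w\<in>strings k. if w = window x 0 k then f w else 0)"
      unfolding F_def by (intro sum.cong) (auto simp: strings_def cylinder_eq_window indicator_def)
    then show ?thesis by simp
  qed
  have cs: "cylinder w \<in> sets \<mu>" for w using s by simp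
  have sp [simp]: "space \<mu> = UNIV" using sets_eq_imp_space_eq[OF s] by simp
  have int: "integrable \<mu> (\<lambda>x. f w * indicator (cylinder w) x)" for w
    using cs by (intro integrable_mult_right integrable_real_indicator) (auto simp: less_top[symmetric])
  have iF: "integrable \<mu> F"
    unfolding F_def by (intro Bochner_Integration.integrable_sum int)
  have IF: "(\<integral>x. F x \<partial>\<mu>) = (\<Sum>w\<in>strings k. block_prob \<mu> w * f w)"
    unfolding F_def using int cs
    by (subst Bochner_Integration.integral_sum) (auto simp: block_prob_def mult.commute)
  have i\<phi>: "integrable \<mu> \<phi>" by (rule integrable_continuous_seq) fact+
  have "\<bar>(\<integral>x. \<phi> x \<partial>\<mu>) - (\<integral>x. F x \<partial>\<mu>)\<bar> = \<bar>\<integral>x. \<phi> x - F x \<partial>\<mu>\<bar>"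
    using i\<phi> iF by simp
  also have "\<dots> \<le> (\<integral>x. \<bar>\<phi> x - F x\<bar> \<partial>\<mu>)" by (rule integral_abs_bound)
  also have "\<dots> \<le> (\<integral>x. e \<partial>\<mu>)"
  proof (rule integral_mono)
    show "integrable \<mu> (\<lambda>x. \<bar>\<phi> x - F x\<bar>)"
      by (intro integrable_abs Bochner_Integration.integrable_diff i\<phi> iF)
    show "\<bar>\<phi> x - F x\<bar> \<le> e" for x using f[of "window x 0 k" x] by (simp add: F)
  qed simp
  also have "\<dots> = e" using prob_space by simp
  finally show ?thesis by (simp add: IF)
qed

lemma invariant_measuresD:
  assumes "\<mu> \<in> invariant_measures" shows "sets \<mu> = sets seq_borel" "prob_space \<mu>"
  using assms by (auto simp: invariant_measures_def)

text \<open>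
  With transition probabilities \<open>g\<close>, the conditional entropies are averages of \<open>- ln g\<close> up to its
  variation on long cylinders.
\<close>

lemma g_family_entropy:
  fixes \<mu> :: "(nat \<Rightarrow> 'a::finite) measure"
  assumes \<mu>: "\<mu> \<in> invariant_measures" and "g_family (block_prob \<mu>) g"
  shows "measure_entropy \<mu> = - (\<integral>x. ln (g x) \<partial>\<mu>)"
proof -
  interpret g_family "block_prob \<mu>" g by fact
  have bound: "\<bar>cond_entropy (block_prob \<mu>) k - (- (\<integral>x. ln (g x) \<partial>\<mu>))\<bar> \<le> variation \<phi> (Suc k)" for k
  proof -
    have "\<bar>(\<integral>x. \<phi> x \<partial>\<mu>) - (\<Sum>w\<in>strings (Suc k). block_prob \<mu> w * (ln (block_prob \<mu> w) - ln (block_prob \<mu> (tl w))))\<bar>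
        \<le> variation \<phi> (Suc k)"
    proof (rule integral_cylinder_approx[OF g_function_ln_cont[OF g_function] invariant_measuresD[OF \<mu>]])
      fix w :: "'a list" and x assume "w \<in> strings (Suc k)" and x: "x \<in> cylinder w"
      then obtain b u where "w = b # u" "length u = k" by (auto simp: strings_def length_Suc_conv)
      then show "\<bar>\<phi> x - (ln (block_prob \<mu> w) - ln (block_prob \<mu> (tl w)))\<bar> \<le> variation \<phi> (Suc k)"
        using ln_ratio[of x b u] x by (auto simp: abs_minus_commute)
    qed
    then show ?thesis unfolding cond_entropy_Cons by linarith
  qed
  have "(\<lambda>k. cond_entropy (block_prob \<mu>) k - (- (\<integral>x. ln (g x) \<partial>\<mu>))) \<longlonglongrightarrow> 0"
    by (rule Lim_null_comparison[OF _ LIMSEQ_Suc[OF variation_tendsto_0[OF g_function_ln_cont[OF g_function]]]])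
      (use bound in simp)
  then show ?thesis by (intro measure_entropy_eqI \<mu>) (simp only: LIM_zero_iff)
qed

text \<open>
  A stationary law with transition probabilities \<open>g\<close> shows that the supremum in the variational
  principle is at least 0. An equilibrium state attains the supremum, and its entropy is at most
  each of its conditional entropies.
\<close>

lemma equilibrium_cond_entropy:
  fixes \<rho> :: "(nat \<Rightarrow> 'a::finite) measure"
  assumes "g_measure g \<rho>"
  shows "0 \<le> cond_entropy (block_prob \<rho>) k + (\<integral>x. ln (g x) \<partial>\<rho>)"
proof -
  have g: "g_function g" and inv: "\<rho> \<in> invariant_measures"
    and eq: "\<And>\<eta>. \<eta> \<in> invariant_measures \<Longrightarrow>
        (\<integral>x. ln (g x) \<partial>\<eta>) + measure_entropy \<eta> \<le> (\<integral>x. ln (g x) \<partial>\<rho>) + measure_entropy \<rho>"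
    using assms by (auto simp: g_measure_def equilibrium_state_def)
  obtain p where "g_family p g" using g_family_exists[OF g] .
  then interpret p: g_family p g .
  obtain \<eta> where \<eta>: "\<eta> \<in> invariant_measures" "block_prob \<eta> = p"
    using p.invariant_measure_exists p.pos by blast
  have "measure_entropy \<eta> = - (\<integral>x. ln (g x) \<partial>\<eta>)"
    by (rule g_family_entropy) (use \<eta> \<open>g_family p g\<close> in auto)
  with eq[OF \<eta>(1)] measure_entropy_le_cond_entropy[OF inv, of k] show ?thesis by linarith
qed

section \<open>Equilibrium states have transition probabilities g\<close>

text \<open>
  An arbitrary point of the cylinder of \<open>u\<close>. The fixed tail matters: the points \<open>pad (b # w)\<close> for
  varying \<open>b\<close> are exactly the preimages of \<open>pad w\<close>, so \<open>g\<close> sums to 1 over them.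
\<close>

definition pad :: "'a list \<Rightarrow> nat \<Rightarrow> 'a" where
  "pad u = (\<lambda>i. if i < length u then u ! i else undefined)"

lemma pad_Cons: "pad (b # u) = case_nat b (pad u)"
  by (auto simp: pad_def fun_eq_iff split: nat.splits)

text \<open>
  The sum on the left is the squared Hellinger distance of the law of words of length \<open>j + 1\<close> from
  the law in which the first letter has conditional probability \<open>g\<close> given the other letters. Their
  divergence is the difference between the integral of \<open>- ln g\<close> and the conditional entropy, up to
  the variation of \<open>ln g\<close>, and for an equilibrium state this difference is at most 0.
\<close>

lemma g_measure_hellinger:
  fixes \<rho> :: "(nat \<Rightarrow> 'a::finite) measure" and g
  assumes "g_measure g \<rho>"
  defines "q \<equiv> block_prob \<rho>"
  shows "(\<Sum>u\<in>strings (Suc j). (sqrt (q u) - sqrt (q (tl u) * g (pad u)))\<^sup>2) \<le> variation (\<lambda>x. ln (g x)) (Suc j)"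
proof -
  have g: "g_function g" and inv: "\<rho> \<in> invariant_measures"
    using assms by (auto simp: g_measure_def equilibrium_state_def)
  note cont = g_function_ln_cont[OF g]
  interpret stationary_family q unfolding q_def by (rule invariant_measures_stationary_family) fact
  let ?Q = "\<lambda>u. q (tl u) * g (pad u)"
  let ?\<phi> = "\<lambda>x. ln (g x)"
  have sumQ: "(\<Sum>u\<in>strings (Suc j). ?Q u) = 1"
    using sum_strings[of j]
    by (simp add: sum_strings_Cons pad_Cons g_function_sum[OF g] flip: sum_distrib_left)
  have tl0: "q u = 0" if "q (tl u) = 0" for u
    using that Cons_le[of "hd u" "tl u"] nonneg[of u] by (cases u) (auto simp: Nil)
  have "\<bar>(\<integral>x. ?\<phi> x \<partial>\<rho>) - (\<Sum>u\<in>strings (Suc j). block_prob \<rho> u * ?\<phi> (pad u))\<bar> \<le> variation ?\<phi> (Suc j)"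
  proof (rule integral_cylinder_approx[OF cont invariant_measuresD[OF inv]])
    fix w :: "'a list" and x assume "w \<in> strings (Suc j)" "x \<in> cylinder w"
    then show "\<bar>?\<phi> x - ?\<phi> (pad w)\<bar> \<le> variation ?\<phi> (Suc j)"
      by (intro variation_le[OF cont]) (auto simp: strings_def cylinder_def pad_def)
  qed
  then have "(\<integral>x. ?\<phi> x \<partial>\<rho>) - variation ?\<phi> (Suc j) \<le> (\<Sum>u\<in>strings (Suc j). q u * ?\<phi> (pad u))"
    unfolding q_def by linarith
  moreover have "0 \<le> cond_entropy q j + (\<integral>x. ?\<phi> x \<partial>\<rho>)"
    unfolding q_def by (rule equilibrium_cond_entropy) fact
  moreover have "(\<Sum>u\<in>strings (Suc j). q u * (ln (q u) - ln (?Q u)))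
      = - cond_entropy q j - (\<Sum>u\<in>strings (Suc j). q u * ?\<phi> (pad u))"
  proof -
    have "q u * (ln (q u) - ln (?Q u)) = q u * (ln (q u) - ln (q (tl u))) - q u * ?\<phi> (pad u)" for u
    proof (cases "q u = 0")
      case False
      then have "0 < q (tl u)" using tl0[of u] nonneg[of "tl u"] by (auto simp: less_le)
      then show ?thesis using g_function_pos[OF g, of "pad u"] by (simp add: ln_mult algebra_simps)
    qed simp
    then show ?thesis by (simp add: cond_entropy_Cons sum_subtractf)
  qed
  moreover have "(\<Sum>u\<in>strings (Suc j). q u - ?Q u + (sqrt (q u) - sqrt (?Q u))\<^sup>2)
      \<le> (\<Sum>u\<in>strings (Suc j). q u * (ln (q u) - ln (?Q u)))"
  proof (intro sum_mono hellinger_pointwise nonneg)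
    fix u
    have "0 < g (pad u)" by (rule g_function_pos[OF g])
    then show "0 \<le> ?Q u" "?Q u = 0 \<Longrightarrow> q u = 0"
      using tl0[of u] nonneg[of "tl u"] by simp_all
  qed
  ultimately show ?thesis by (simp add: sum.distrib sum_subtractf sum_strings sumQ)
qed

text \<open>
  The triangle inequality in \<open>\<ell>\<^sup>2\<close> for the square roots. It turns the Hellinger bound for
  words of length \<open>j + 1\<close> into a bound for the event that a word starts with given letters.
\<close>

lemma sqrt_sum_diff_le:
  fixes P Q :: "'b \<Rightarrow> real"
  assumes "\<And>x. x \<in> W \<Longrightarrow> 0 \<le> P x" "\<And>x. x \<in> W \<Longrightarrow> 0 \<le> Q x"
  shows "sqrt (\<Sum>x\<in>W. P x) \<le> sqrt (\<Sum>x\<in>W. (sqrt (P x) - sqrt (Q x))\<^sup>2) + sqrt (\<Sum>x\<in>W. Q x)"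
  using L2_set_triangle_ineq[of "\<lambda>x. sqrt (P x) - sqrt (Q x)" "\<lambda>x. sqrt (Q x)" W] assms
  by (simp add: L2_set_def)

text \<open>
  For a word \<open>b # w\<close> the quantity \<open>R b w m\<close> is its probability when the first letter is drawn from
  \<open>g\<close> given the next \<open>length w + m\<close> letters. This is \<open>q w\<close> times an average of values of \<open>g\<close> on
  the cylinder of \<open>b # w\<close>. As \<open>m\<close> grows, the Hellinger bound forces it to converge to
  \<open>q (b # w)\<close>, so the limit satisfies the exact bounds of a \<open>g_family\<close>.
\<close>

lemma g_measure_g_family:
  fixes \<rho> :: "(nat \<Rightarrow> 'a::finite) measure"
  assumes \<rho>: "g_measure g \<rho>"
  shows "g_family (block_prob \<rho>) g"
proof -
  define q where "q = block_prob \<rho>"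
  define v where "v = variation (\<lambda>x. ln (g x))"
  have g: "g_function g" and inv: "\<rho> \<in> invariant_measures"
    using assms by (auto simp: g_measure_def equilibrium_state_def)
  note cont = g_function_ln_cont[OF g]
  interpret stationary_family q unfolding q_def by (rule invariant_measures_stationary_family) fact
  define R where "R b w m = (\<Sum>s\<in>strings m. q (w @ s) * g (pad (b # w @ s)))" for b w m
  have close: "\<bar>sqrt (q (b # w)) - sqrt (R b w m)\<bar> \<le> sqrt (v (Suc (length w + m)))" for b w m
  proof -
    let ?W = "(\<lambda>s. b # w @ s) ` strings m"
    let ?P = q and ?Q = "\<lambda>u. q (tl u) * g (pad u)"
    have inj: "inj_on (\<lambda>s. b # w @ s) (strings m)" by (auto simp: inj_on_def)
    have P: "(\<Sum>u\<in>?W. ?P u) = q (b # w)"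
      using sum_suffix[of "b # w" m] by (simp add: sum.reindex[OF inj])
    have Q: "(\<Sum>u\<in>?W. ?Q u) = R b w m" by (simp add: sum.reindex[OF inj] R_def)
    have "(\<Sum>u\<in>?W. (sqrt (?P u) - sqrt (?Q u))\<^sup>2)
        \<le> (\<Sum>u\<in>strings (Suc (length w + m)). (sqrt (?P u) - sqrt (?Q u))\<^sup>2)"
    proof (rule sum_mono2)
      show "?W \<subseteq> strings (Suc (length w + m))" by (auto simp: strings_def)
    qed auto
    also have "\<dots> \<le> v (Suc (length w + m))"
      unfolding v_def q_def by (rule g_measure_hellinger) fact
    finally have D: "sqrt (\<Sum>u\<in>?W. (sqrt (?P u) - sqrt (?Q u))\<^sup>2) \<le> sqrt (v (Suc (length w + m)))"
      by simp
    have Q0: "0 \<le> ?Q u" for u using g_function_pos[OF g, of "pad u"] nonneg[of "tl u"] by simp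
    have swap: "(\<Sum>u\<in>?W. (sqrt (?Q u) - sqrt (?P u))\<^sup>2) = (\<Sum>u\<in>?W. (sqrt (?P u) - sqrt (?Q u))\<^sup>2)"
      by (intro sum.cong refl power2_commute)
    show ?thesis
      using sqrt_sum_diff_le[of ?W ?P ?Q, OF nonneg Q0] sqrt_sum_diff_le[of ?W ?Q ?P, OF Q0 nonneg] D
      unfolding P Q swap by linarith
  qed
  have lim: "(\<lambda>m. sqrt (R b w m)) \<longlonglongrightarrow> sqrt (q (b # w))" for b w
  proof -
    have "(\<lambda>m. v (m + Suc (length w))) \<longlonglongrightarrow> 0"
      unfolding v_def by (rule LIMSEQ_ignore_initial_segment[OF variation_tendsto_0[OF cont]])
    then have "(\<lambda>m. sqrt (v (m + Suc (length w)))) \<longlonglongrightarrow> 0"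
      using tendsto_real_sqrt by fastforce
    moreover have "\<bar>sqrt (R b w m) - sqrt (q (b # w))\<bar> \<le> sqrt (v (m + Suc (length w)))" for m
      using close[of b w m] by (simp add: abs_minus_commute add.commute)
    ultimately have "(\<lambda>m. sqrt (R b w m) - sqrt (q (b # w))) \<longlonglongrightarrow> 0"
      by - (rule Lim_null_comparison[where g = "\<lambda>m. sqrt (v (m + Suc (length w)))"], simp_all)
    then show ?thesis by (simp only: LIM_zero_iff)
  qed
  have cyl: "pad (b # w @ s) \<in> cylinder (b # w)" for b w s
    by (auto simp: pad_def cylinder_def nth_Cons nth_append split: nat.splits)
  have "g_family q g"
  proof
    fix b w m
    show "m * q w \<le> q (b # w)" if *: "\<And>x. x \<in> cylinder (b # w) \<Longrightarrow> m \<le> g x"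
    proof -
      have "m * q w \<le> R b w j" for j
        unfolding R_def sum_suffix[of w j, symmetric] sum_distrib_left
        by (intro sum_mono) (use mult_right_mono[OF *[OF cyl] nonneg] in \<open>simp add: mult.commute\<close>)
      then have "sqrt (m * q w) \<le> sqrt (q (b # w))"
        by (intro LIMSEQ_le_const[OF lim]) auto
      then show ?thesis by simp
    qed
    show "q (b # w) \<le> m * q w" if *: "\<And>x. x \<in> cylinder (b # w) \<Longrightarrow> g x \<le> m"
    proof -
      have "R b w j \<le> m * q w" for j
        unfolding R_def sum_suffix[of w j, symmetric] sum_distrib_left
        by (intro sum_mono) (use mult_right_mono[OF *[OF cyl] nonneg] in \<open>simp add: mult.commute\<close>)
      then have "sqrt (q (b # w)) \<le> sqrt (m * q w)"
        by (intro LIMSEQ_le_const2[OF lim]) auto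
      then show ?thesis by simp
    qed
  qed (rule g)
  then show ?thesis by (simp add: q_def)
qed

section \<open>Empirical word frequencies\<close>

lemma sum_periodic_shift:
  fixes f :: "nat \<Rightarrow> real"
  assumes "\<And>i. f (i + n) = f i"
  shows "(\<Sum>i<n. f (i + j)) = (\<Sum>i<n. f i)"
proof (induction j)
  case (Suc j)
  have "f j + (\<Sum>i<n. f (i + Suc j)) = (\<Sum>i<Suc n. f (i + j))"
    by (subst sum.lessThan_Suc_shift) simp
  also have "\<dots> = (\<Sum>i<n. f (i + j)) + f j"
    using assms[of j] by (simp add: add.commute)
  finally show ?case using Suc by simp
qed simp

lemma periodic_ext_add [simp]: "periodic_ext xs (i + length xs) = periodic_ext xs i"
  by (simp add: periodic_ext_def)

lemma window_periodic_add [simp]: "window (periodic_ext xs) (i + length xs) k = window (periodic_ext xs) i k"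
proof -
  have "periodic_ext xs (i + length xs + j) = periodic_ext xs (i + j)" for j
    using periodic_ext_add[of xs "i + j"] by (simp add: add_ac)
  then show ?thesis by (simp add: list_eq_iff_nth_eq)
qed

lemma funpow_shift_periodic_add [simp]:
  "(shift ^^ (i + length xs)) (periodic_ext xs) = (shift ^^ i) (periodic_ext xs)"
proof -
  have "periodic_ext xs (i + length xs + j) = periodic_ext xs (i + j)" for j
    using periodic_ext_add[of xs "i + j"] by (simp add: add_ac)
  then show ?thesis by (simp add: funpow_shift)
qed

lemma window_periodic_ext [simp]: "window (periodic_ext xs) 0 (length xs) = xs"
  by (simp add: list_eq_iff_nth_eq periodic_ext_def)

definition word_count :: "'a list \<Rightarrow> 'a list \<Rightarrow> nat" where
  "word_count xs as = card {i. i < length xs \<and> window (periodic_ext xs) i (length as) = as}"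

lemma empirical_prob_word_count: "empirical_prob xs as = real (word_count xs as) / real (length xs)"
  by (simp add: empirical_prob_def word_count_def window_def)

lemma empirical_prob_eq_sum:
  "empirical_prob xs as = (\<Sum>i<length xs. of_bool (window (periodic_ext xs) i (length as) = as)) / real (length xs)"
proof -
  have "{i. i < length xs \<and> window (periodic_ext xs) i (length as) = as}
      = {..<length xs} \<inter> {i. window (periodic_ext xs) i (length as) = as}" by auto
  then show ?thesis by (simp add: empirical_prob_word_count word_count_def of_bool_def sum.If_cases)
qed

lemma empirical_expectation:
  fixes xs :: "'a::finite list"
  shows "(\<Sum>as\<in>strings k. empirical_prob xs as * f as)
    = (\<Sum>i<length xs. f (window (periodic_ext xs) i k)) / real (length xs)"
proof -
  have "(\<Sum>as\<in>strings k. empirical_prob xs as * f as)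
      = (\<Sum>as\<in>strings k. \<Sum>i<length xs. of_bool (window (periodic_ext xs) i k = as) * f as) / real (length xs)"
    unfolding sum_divide_distrib empirical_prob_eq_sum
    by (intro sum.cong) (auto simp: strings_def sum_distrib_right)
  also have "(\<Sum>as\<in>strings k. \<Sum>i<length xs. of_bool (window (periodic_ext xs) i k = as) * f as)
      = (\<Sum>i<length xs. \<Sum>as\<in>strings k. if as = window (periodic_ext xs) i k then f as else 0)"
    by (subst sum.swap) (auto intro!: sum.cong)
  finally show ?thesis by simp
qed

text \<open>
  Consistency on both sides is exact because the windows are taken cyclically.
\<close>

lemma stationary_family_empirical:
  fixes xs :: "'a::finite list"
  assumes "xs \<noteq> []"
  shows "stationary_family (empirical_prob xs)"
proof
  fix w :: "'a list"
  let ?x = "periodic_ext xs" and ?n = "length xs"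
  show "0 \<le> empirical_prob xs w" by (simp add: empirical_prob_def)
  show "empirical_prob xs [] = 1" using assms by (simp add: empirical_prob_def)
  have "(\<Sum>b\<in>UNIV. of_bool (window ?x i (length (w @ [b])) = w @ [b]))
      = (of_bool (window ?x i (length w) = w) :: real)" for i
  proof -
    have "(\<Sum>b\<in>UNIV. of_bool (window ?x i (length (w @ [b])) = w @ [b]))
      = (\<Sum>b\<in>UNIV. if b = ?x (i + length w) then of_bool (window ?x i (length w) = w) else (0::real))"
      by (intro sum.cong) (auto simp: window_Suc_snoc)
    then show ?thesis by simp
  qed
  then show "(\<Sum>b\<in>UNIV. empirical_prob xs (w @ [b])) = empirical_prob xs w"
    unfolding empirical_prob_eq_sum sum_divide_distrib[symmetric] by (subst sum.swap) simp
  have "(\<Sum>b\<in>UNIV. of_bool (window ?x i (length (b # w)) = b # w))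
      = (of_bool (window ?x (i + 1) (length w) = w) :: real)" for i
  proof -
    have "(\<Sum>b\<in>UNIV. of_bool (window ?x i (length (b # w)) = b # w))
      = (\<Sum>b\<in>UNIV. if b = ?x i then of_bool (window ?x (Suc i) (length w) = w) else (0::real))"
      by (intro sum.cong) (auto simp: window_Suc)
    then show ?thesis by simp
  qed
  moreover have "(\<Sum>i<?n. of_bool (window ?x (i + 1) (length w) = w)) = (\<Sum>i<?n. of_bool (window ?x i (length w) = w) :: real)"
    by (rule sum_periodic_shift) simp
  ultimately show "(\<Sum>b\<in>UNIV. empirical_prob xs (b # w)) = empirical_prob xs w"
    unfolding empirical_prob_eq_sum sum_divide_distrib[symmetric] by (subst sum.swap) simp
qed

lemma empirical_prob_window_pos:
  assumes "i < length xs" shows "0 < empirical_prob xs (window (periodic_ext xs) i k)"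
proof -
  have "i \<in> {i'. i' < length xs \<and> window (periodic_ext xs) i' k = window (periodic_ext xs) i k}"
    using assms by simp
  then have "0 < word_count xs (window (periodic_ext xs) i k)"
    unfolding word_count_def by (subst card_gt_0_iff) auto
  then show ?thesis using assms unfolding empirical_prob_word_count by (intro divide_pos_pos) auto
qed

section \<open>Periodic orbit measures\<close>

definition orbit_measure :: "'a list \<Rightarrow> (nat \<Rightarrow> 'a) measure" where
  "orbit_measure xs = distr (measure_pmf (pmf_of_set {..<length xs})) seq_borel (\<lambda>i. (shift ^^ i) (periodic_ext xs))"

lemma measure_orbit_measure:
  fixes xs :: "'a::finite list"
  assumes "xs \<noteq> []" "B \<in> sets seq_borel"
  shows "measure (orbit_measure xs) B
    = real (card {i. i < length xs \<and> (shift ^^ i) (periodic_ext xs) \<in> B}) / real (length xs)"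
proof -
  have "measure (orbit_measure xs) B = measure (measure_pmf (pmf_of_set {..<length xs}))
     ((\<lambda>i. (shift ^^ i) (periodic_ext xs)) -` B)"
    unfolding orbit_measure_def using assms by (subst measure_distr) (auto intro: measurable_seq_borelI)
  also have "\<dots> = real (card ({..<length xs} \<inter> (\<lambda>i. (shift ^^ i) (periodic_ext xs)) -` B)) / real (length xs)"
    using assms by (subst measure_pmf_of_set) auto
  also have "{..<length xs} \<inter> (\<lambda>i. (shift ^^ i) (periodic_ext xs)) -` B
      = {i. i < length xs \<and> (shift ^^ i) (periodic_ext xs) \<in> B}" by auto
  finally show ?thesis .
qed

text \<open>
  An invariant set contains either all points of a periodic orbit or none of them.
\<close>

lemma orbit_measure_ergodic:
  fixes xs :: "'a::finite list"
  assumes "xs \<noteq> []"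
  shows "orbit_measure xs \<in> ergodic_measures"
proof -
  have "block_prob (orbit_measure xs) = empirical_prob xs"
  proof
    fix w :: "'a list"
    have "(shift ^^ i) (periodic_ext xs) \<in> cylinder w \<longleftrightarrow> window (periodic_ext xs) i (length w) = w" for i
      by (simp add: cylinder_eq_window window_funpow_shift)
    then show "block_prob (orbit_measure xs) w = empirical_prob xs w"
      using assms by (simp add: block_prob_def measure_orbit_measure empirical_prob_word_count word_count_def)
  qed
  then have "orbit_measure xs \<in> invariant_measures"
    using stationary_family_empirical[OF assms]
    by (intro invariant_measuresI)
      (auto simp: orbit_measure_def intro!: prob_space.prob_space_distr prob_space_measure_pmf measurable_seq_borelI)
  moreover have "measure (orbit_measure xs) B = 0 \<or> measure (orbit_measure xs) B = 1"
    if "B \<in> sets seq_borel" "shift -` B = B" for B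
  proof -
    have "(shift ^^ i) x \<in> B \<longleftrightarrow> x \<in> B" for i x
    proof (induction i)
      case (Suc i)
      have "shift y \<in> B \<longleftrightarrow> y \<in> B" for y using that(2) by (metis vimage_eq)
      then show ?case using Suc by simp
    qed simp
    then show ?thesis using assms that(1)
      by (cases "periodic_ext xs \<in> B") (simp_all add: measure_orbit_measure)
  qed
  ultimately show ?thesis by (auto simp: ergodic_measures_def)
qed

definition orbit_average :: "((nat \<Rightarrow> 'a) \<Rightarrow> real) \<Rightarrow> 'a list \<Rightarrow> real" where
  "orbit_average \<phi> xs = (\<Sum>i<length xs. \<phi> ((shift ^^ i) (periodic_ext xs))) / real (length xs)"

lemma integral_orbit_measure:
  fixes \<phi> :: "(nat \<Rightarrow> 'a::finite) \<Rightarrow> real"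
  assumes "xs \<noteq> []" "continuous_map seq_topology euclideanreal \<phi>"
  shows "(\<integral>x. \<phi> x \<partial>orbit_measure xs) = orbit_average \<phi> xs"
  unfolding orbit_measure_def orbit_average_def using assms
  by (subst integral_distr) (auto intro!: measurable_seq_borelI borel_measurable_continuous_seq simp: integral_pmf_of_set lessThan_empty_iff)

section \<open>Counting strings by their word counts\<close>

text \<open>
  Read \<open>q (b # w)\<close> as the probability that \<open>b\<close> precedes the word \<open>w\<close>. The product is then the
  probability of generating \<open>u\<close> letter by letter from right to left, starting from the context
  \<open>s\<close>.
\<close>

lemma sum_markov_weights_le_1:
  fixes q :: "'a::finite list \<Rightarrow> real"
  assumes q0: "\<And>w. 0 \<le> q w" and q1: "\<And>w. (\<Sum>b\<in>UNIV. q (b # w)) \<le> 1"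
  shows "(\<Sum>u\<in>strings n. \<Prod>i<n. q (take (Suc j) (drop i (u @ s)))) \<le> 1"
proof (induction n)
  case (Suc n)
  let ?P = "\<lambda>u. \<Prod>i<n. q (take (Suc j) (drop i (u @ s)))"
  have "(\<Sum>u\<in>strings (Suc n). \<Prod>i<Suc n. q (take (Suc j) (drop i (u @ s))))
      = (\<Sum>u\<in>strings n. (\<Sum>b\<in>UNIV. q (b # take j (u @ s))) * ?P u)"
    by (simp add: sum_strings_Cons prod.lessThan_Suc_shift sum_distrib_right del: prod.lessThan_Suc)
  also have "\<dots> \<le> (\<Sum>u\<in>strings n. 1 * ?P u)"
    by (intro sum_mono mult_right_mono q1 prod_nonneg) (auto intro: q0)
  also have "\<dots> \<le> 1" using Suc by simp
  finally show ?case .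
qed (simp add: strings_0)

text \<open>
  The left side is the maximal likelihood of \<open>xs\<close>, read cyclically, among the Markov chains of order
  \<open>j\<close>. It is attained by the empirical transition probabilities.
\<close>

lemma exp_empirical_cond_entropy:
  fixes xs :: "'a::finite list"
  assumes "xs \<noteq> []"
  shows "exp (- real (length xs) * cond_entropy (empirical_prob xs) j)
    = (\<Prod>i<length xs. empirical_prob xs (window (periodic_ext xs) i (Suc j))
         / empirical_prob xs (tl (window (periodic_ext xs) i (Suc j))))"
proof -
  interpret stationary_family "empirical_prob xs" by (rule stationary_family_empirical) fact
  let ?q = "\<lambda>i. empirical_prob xs (window (periodic_ext xs) i (Suc j))
         / empirical_prob xs (tl (window (periodic_ext xs) i (Suc j)))"
  have pos: "0 < empirical_prob xs (window (periodic_ext xs) i (Suc j))"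
    "0 < empirical_prob xs (tl (window (periodic_ext xs) i (Suc j)))" if "i < length xs" for i
  proof -
    show 1: "0 < empirical_prob xs (window (periodic_ext xs) i (Suc j))"
      by (rule empirical_prob_window_pos[OF that])
    show "0 < empirical_prob xs (tl (window (periodic_ext xs) i (Suc j)))"
      using 1 Cons_le[of "periodic_ext xs i" "window (periodic_ext xs) (Suc i) j"] by (simp add: window_Suc)
  qed
  have lnq: "ln (?q i) = ln (empirical_prob xs (window (periodic_ext xs) i (Suc j)))
      - ln (empirical_prob xs (tl (window (periodic_ext xs) i (Suc j))))" if "i < length xs" for i
    using pos[OF that] by (simp add: ln_div)
  have "- real (length xs) * cond_entropy (empirical_prob xs) j = (\<Sum>i<length xs. ln (?q i))"
    unfolding cond_entropy_Cons empirical_expectation using assms by (simp add: lnq cong: sum.cong_simp)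
  also have "exp \<dots> = (\<Prod>i<length xs. ?q i)"
    using pos by (simp add: exp_sum)
  finally show ?thesis .
qed

lemma word_count_le: "word_count xs as \<le> length xs"
proof -
  have "word_count xs as \<le> card {..<length xs}"
    unfolding word_count_def by (intro card_mono) auto
  then show ?thesis by simp
qed

text \<open>
  The maximal likelihood of a string is its likelihood under a Markov chain that depends only on the
  word counts of the string, started at a context of length \<open>j\<close>. Bounding it by the sum of the
  likelihoods over all count vectors and all contexts and exchanging the sums leaves, for each count
  vector and context, a sum of likelihoods that is at most 1.
\<close>

lemma sum_exp_cond_entropy_le:
  assumes n: "0 < n"
  shows "(\<Sum>xs\<in>(strings n :: 'a::finite list set). exp (- real n * cond_entropy (empirical_prob xs) j))
    \<le> real ((n + 1) ^ (CARD('a) ^ Suc j) * CARD('a) ^ j)"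
proof -
  define T where "T = PiE (strings (Suc j) :: 'a list set) (\<lambda>_. {..n})"
  \<comment> \<open>Transition probabilities given by counts. Where the denominator is 0 the value is 0.\<close>
  define q where "q m w = real (m w) / real (\<Sum>b\<in>UNIV. m (b # tl w))" for m :: "'a list \<Rightarrow> nat" and w
  define W where "W m s xs = (\<Prod>i<n. q m (take (Suc j) (drop i (xs @ s))))" for m s xs
  have q0: "0 \<le> q m w" for m w
    unfolding q_def by (rule divide_nonneg_nonneg) (rule of_nat_0_le_iff)+
  have q1: "(\<Sum>b\<in>UNIV. q m (b # w)) \<le> 1" for m w
  proof -
    have "(\<Sum>b\<in>UNIV. q m (b # w)) = (\<Sum>b\<in>UNIV. real (m (b # w))) / (\<Sum>b\<in>UNIV. real (m (b # w)))"
      unfolding q_def list.sel of_nat_sum sum_divide_distrib ..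
    also have "\<dots> \<le> 1" by (simp only: divide_le_eq_1) linarith
    finally show ?thesis .
  qed
  have W0: "0 \<le> W m s xs" for m s xs unfolding W_def by (intro prod_nonneg) (auto intro: q0)
  have finT: "finite T" unfolding T_def by (intro finite_PiE) auto
  have cardT: "card T = (n + 1) ^ (CARD('a) ^ Suc j)"
    unfolding T_def by (subst card_PiE) (simp_all add: card_strings del: power_Suc)
  have "exp (- real n * cond_entropy (empirical_prob xs) j) \<le> (\<Sum>m\<in>T. \<Sum>s\<in>strings j. W m s xs)"
    if xs: "xs \<in> strings n" for xs :: "'a list"
  proof -
    have len: "length xs = n" and ne: "xs \<noteq> []" using xs n by (auto simp: strings_def)
    interpret stationary_family "empirical_prob xs" by (rule stationary_family_empirical) fact
    define m where "m = restrict (word_count xs) (strings (Suc j))"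
    \<comment> \<open>The cyclic windows of \<open>xs\<close> are the windows of \<open>xs\<close> followed by this context.\<close>
    define s where "s = window (periodic_ext xs) n j"
    have mT: "m \<in> T" using word_count_le[of xs] len by (auto simp: T_def m_def)
    have win: "take (Suc j) (drop i (xs @ s)) = window (periodic_ext xs) i (Suc j)" if "i < n" for i
    proof -
      have eq: "xs @ s = window (periodic_ext xs) 0 (n + j)"
        using window_periodic_ext[of xs] unfolding len s_def window_def
        by (metis add_0 le_add1 map_append upt_add_eq_append)
      show ?thesis unfolding eq using that by (auto simp: list_eq_iff_nth_eq)
    qed
    have qm: "q m w = empirical_prob xs w / empirical_prob xs (tl w)" if w: "w \<in> strings (Suc j)" for w
    proof -
      have "tl w \<in> strings j" using w by (auto simp: strings_def)
      then have "(\<Sum>b\<in>UNIV. m (b # tl w)) = (\<Sum>b\<in>UNIV. word_count xs (b # tl w))"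
        by (intro sum.cong) (auto simp: m_def strings_def)
      moreover have "real (\<Sum>b\<in>UNIV. word_count xs (b # tl w)) / real n = empirical_prob xs (tl w)"
        unfolding Cons[of "tl w", symmetric] by (simp add: empirical_prob_word_count len sum_divide_distrib)
      moreover have "m w = word_count xs w" using w by (simp add: m_def)
      ultimately show ?thesis
        using n unfolding q_def by (simp add: empirical_prob_word_count len field_simps)
    qed
    have "exp (- real n * cond_entropy (empirical_prob xs) j) = W m s xs"
      using exp_empirical_cond_entropy[OF ne, of j] unfolding len W_def
      by (simp add: win qm del: take_append drop_append cong: prod.cong_simp)
    also have "\<dots> \<le> (\<Sum>s\<in>strings j. W m s xs)"
      by (rule member_le_sum) (auto simp: s_def W0)
    also have "\<dots> \<le> (\<Sum>m\<in>T. \<Sum>s\<in>strings j. W m s xs)"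
      by (rule member_le_sum[where f = "\<lambda>m. \<Sum>s\<in>strings j. W m s xs"]) (auto simp: mT finT W0 sum_nonneg)
    finally show ?thesis .
  qed
  then have "(\<Sum>xs\<in>(strings n :: 'a list set). exp (- real n * cond_entropy (empirical_prob xs) j))
      \<le> (\<Sum>xs\<in>strings n. \<Sum>m\<in>T. \<Sum>s\<in>strings j. W m s xs)"
    by (intro sum_mono)
  also have "\<dots> = (\<Sum>m\<in>T. \<Sum>s\<in>strings j. \<Sum>xs\<in>strings n. W m s xs)"
    by (subst sum.swap) (intro sum.cong refl sum.swap)
  also have "\<dots> \<le> (\<Sum>m\<in>T. \<Sum>s\<in>(strings j :: 'a list set). 1)"
    unfolding W_def by (intro sum_mono sum_markov_weights_le_1 q0 q1)
  also have "\<dots> = real ((n + 1) ^ (CARD('a) ^ Suc j) * CARD('a) ^ j)"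
    by (simp add: cardT card_strings)
  finally show ?thesis .
qed

section \<open>Relative entropies of empirical frequencies\<close>

lemma (in stationary_family) tl_zero: "p (tl w) = 0 \<Longrightarrow> p w = 0"
  using Cons_le[of "hd w" "tl w"] nonneg[of w] by (cases w) (auto simp: Nil)

locale equilibrium =
  fixes g :: "(nat \<Rightarrow> 'a::finite) \<Rightarrow> real" and \<rho> :: "(nat \<Rightarrow> 'a) measure"
  assumes g_measure: "g_measure g \<rho>"
begin

sublocale g_family "block_prob \<rho>" g
  by (rule g_measure_g_family[OF g_measure])

abbreviation r where "r \<equiv> block_prob \<rho>"

text \<open>
  The uniform error in comparing \<open>ln (r w)\<close> for words of length \<open>n\<close> with Birkhoff sums of \<open>\<phi>\<close>.
\<close>

definition defect :: "nat \<Rightarrow> real" where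
  "defect n = (\<Sum>j<n. variation \<phi> (Suc j))"

lemmas cont = g_function_ln_cont[OF g_function]

lemma defect_mono: "m \<le> n \<Longrightarrow> defect m \<le> defect n"
  unfolding defect_def by (intro sum_mono2) (auto intro: variation_nonneg[OF cont])

lemma defect_nonneg: "0 \<le> defect n"
  unfolding defect_def by (intro sum_nonneg variation_nonneg[OF cont])

lemma defect_average: "(\<lambda>n. defect n / real n) \<longlonglongrightarrow> 0"
  unfolding defect_def by (intro cesaro LIMSEQ_Suc variation_tendsto_0 cont)

lemma ln_block_prob_orbit_average:
  assumes "xs \<noteq> []"
  shows "\<bar>ln (r xs) - real (length xs) * orbit_average \<phi> xs\<bar> \<le> defect (length xs)"
  using ln_window[of "periodic_ext xs" 0 "length xs"] assms by (simp add: orbit_average_def defect_def)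

lemma rel_entropy_eq:
  assumes "stationary_family \<nu>"
  shows "rel_entropy k \<nu> \<rho> = (\<Sum>w\<in>strings k. \<nu> w * (ln (\<nu> w) - ln (r w)))"
proof -
  interpret N: stationary_family \<nu> by fact
  have t: "\<nu> w * ln (\<nu> w / r w) = \<nu> w * (ln (\<nu> w) - ln (r w))" for w
    using pos[of w] by (cases "\<nu> w = 0") (simp_all add: ln_div)
  show ?thesis by (cases "k = 0") (simp_all add: rel_entropy_def strings_0 N.Nil Nil t)
qed

lemma rel_entropy_word_entropy:
  assumes "stationary_family \<nu>"
  shows "rel_entropy k \<nu> \<rho> = - word_entropy \<nu> k - (\<Sum>w\<in>strings k. \<nu> w * ln (r w))"
  unfolding rel_entropy_eq[OF assms] word_entropy_def by (simp add: right_diff_distrib sum_subtractf)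

lemma rel_entropy_nonneg:
  assumes "stationary_family \<nu>" shows "0 \<le> rel_entropy k \<nu> \<rho>"
proof -
  interpret N: stationary_family \<nu> by fact
  show ?thesis
    using gibbs_inequality[of "strings k" \<nu> r] pos nonneg N.nonneg
    by (simp add: rel_entropy_eq[OF assms] sum_strings N.sum_strings less_imp_neq[symmetric])
qed

lemma cond_rel_entropy_eq:
  assumes "stationary_family \<nu>"
  shows "cond_rel_entropy (Suc j) \<nu> \<rho>
    = - cond_entropy \<nu> j - (\<Sum>w\<in>strings (Suc j). \<nu> w * (ln (r w) - ln (r (tl w))))"
proof -
  interpret N: stationary_family \<nu> by fact
  have m: "marginal \<nu> = \<nu>" by (rule ext) (simp add: marginal_def N.snoc)
  have "(\<Sum>w\<in>strings (Suc j). \<nu> w * ln (r (tl w))) = (\<Sum>w\<in>strings j. \<nu> w * ln (r w))"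
    by (rule N.sum_Cons_tl)
  then show ?thesis
    by (simp add: cond_rel_entropy_def m rel_entropy_word_entropy[OF assms] cond_entropy_def
        right_diff_distrib sum_subtractf)
qed

text \<open>
  The conditional relative entropy is the divergence of \<open>\<nu>\<close> from the law \<open>Q\<close> that keeps the
  distribution of the last \<open>j\<close> letters and takes the first letter from the conditional
  probabilities of \<open>\<rho>\<close>.
\<close>

lemma cond_rel_entropy_nonneg:
  assumes "stationary_family \<nu>" shows "0 \<le> cond_rel_entropy (Suc j) \<nu> \<rho>"
proof -
  interpret N: stationary_family \<nu> by fact
  define Q where "Q w = \<nu> (tl w) * (r w / r (tl w))" for w
  have "(\<Sum>w\<in>strings (Suc j). Q w) = (\<Sum>w\<in>strings j. \<nu> w * ((\<Sum>b\<in>UNIV. r (b # w)) / r w))"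
    by (simp add: Q_def sum_strings_Cons sum_distrib_left sum_divide_distrib)
  also have "\<dots> = 1"
    using pos N.sum_strings[of j] by (simp add: Cons less_imp_neq[symmetric])
  finally have sumQ: "(\<Sum>w\<in>strings (Suc j). Q w) = 1" .
  have t: "\<nu> w * (ln (\<nu> w) - ln (Q w)) = \<nu> w * (ln (\<nu> w) - ln (\<nu> (tl w))) - \<nu> w * (ln (r w) - ln (r (tl w)))" for w
  proof (cases "\<nu> w = 0")
    case False
    then have "0 < \<nu> (tl w)" using N.tl_zero[of w] N.nonneg[of "tl w"] by (auto simp: less_le)
    then have lnQ: "ln (Q w) = ln (\<nu> (tl w)) + (ln (r w) - ln (r (tl w)))"
      unfolding Q_def using pos[of w] pos[of "tl w"] by (subst ln_mult) (simp_all add: ln_div)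
    show ?thesis unfolding lnQ by (simp add: algebra_simps)
  qed simp
  have "cond_rel_entropy (Suc j) \<nu> \<rho> = (\<Sum>w\<in>strings (Suc j). \<nu> w * (ln (\<nu> w) - ln (Q w)))"
    by (simp add: t cond_rel_entropy_eq[OF assms] N.cond_entropy_Cons sum_subtractf)
  moreover have "(\<Sum>w\<in>strings (Suc j). \<nu> w) - (\<Sum>w\<in>strings (Suc j). Q w)
      \<le> (\<Sum>w\<in>strings (Suc j). \<nu> w * (ln (\<nu> w) - ln (Q w)))"
  proof (rule gibbs_inequality)
    fix w
    have *: "0 < r w / r (tl w)" using pos by simp
    show "0 \<le> Q w" unfolding Q_def by (intro mult_nonneg_nonneg N.nonneg less_imp_le[OF *])
    show "\<nu> w = 0" if "Q w = 0"
    proof (rule N.tl_zero)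
      show "\<nu> (tl w) = 0" using that less_imp_neq[OF *] unfolding Q_def by (metis mult_eq_0_iff)
    qed
  qed (rule N.nonneg)
  ultimately show ?thesis by (simp add: sumQ N.sum_strings)
qed

text \<open>
  The definition compares the last letter with the preceding ones. By stationarity the first letter
  may be compared with the following ones instead, and there the conditional probabilities of \<open>\<rho>\<close>
  are close to \<open>g\<close>.
\<close>

lemma emp_cond_rel_entropy_approx:
  assumes "xs \<noteq> []"
  shows "\<bar>emp_cond_rel_entropy (Suc j) xs \<rho> - (- cond_entropy (empirical_prob xs) j - orbit_average \<phi> xs)\<bar>
    \<le> variation \<phi> (Suc j)"
proof -
  let ?x = "periodic_ext xs" and ?v = "variation \<phi> (Suc j)" and ?n = "length xs"
  let ?f = "\<lambda>i. ln (r (window ?x i (Suc j))) - ln (r (window ?x (Suc i) j))"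
  have n: "0 < ?n" using assms by simp
  have "\<bar>?f i - \<phi> ((shift ^^ i) ?x)\<bar> \<le> ?v" for i by (rule ln_ratio_window)
  then have "(\<Sum>i<?n. \<bar>?f i - \<phi> ((shift ^^ i) ?x)\<bar>) \<le> (\<Sum>i<?n. ?v)" by (intro sum_mono)
  then have "\<bar>\<Sum>i<?n. ?f i - \<phi> ((shift ^^ i) ?x)\<bar> \<le> real ?n * ?v"
    by (intro order_trans[OF sum_abs]) simp
  then have "\<bar>(\<Sum>i<?n. ?f i - \<phi> ((shift ^^ i) ?x)) / real ?n\<bar> \<le> ?v"
    using n by (simp add: abs_divide divide_le_eq mult.commute)
  moreover have "emp_cond_rel_entropy (Suc j) xs \<rho>
      = - cond_entropy (empirical_prob xs) j - (\<Sum>i<?n. ?f i) / real ?n"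
    unfolding emp_cond_rel_entropy_def cond_rel_entropy_eq[OF stationary_family_empirical[OF assms]]
      empirical_expectation by (simp add: window_Suc)
  ultimately show ?thesis
    by (simp add: orbit_average_def sum_subtractf diff_divide_distrib abs_minus_commute)
qed

lemma emp_rel_entropy_approx:
  assumes "xs \<noteq> []"
  shows "\<bar>emp_rel_entropy k xs \<rho> - (- word_entropy (empirical_prob xs) k - real k * orbit_average \<phi> xs)\<bar>
    \<le> defect k"
proof -
  let ?x = "periodic_ext xs" and ?n = "length xs"
  let ?f = "\<lambda>i. ln (r (window ?x i k))" and ?S = "\<lambda>i. \<Sum>j<k. \<phi> ((shift ^^ (i + j)) ?x)"
  have n: "0 < ?n" using assms by simp
  have "\<bar>?f i - ?S i\<bar> \<le> defect k" for i unfolding defect_def by (rule ln_window)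
  then have "(\<Sum>i<?n. \<bar>?f i - ?S i\<bar>) \<le> (\<Sum>i<?n. defect k)" by (intro sum_mono)
  then have "\<bar>\<Sum>i<?n. ?f i - ?S i\<bar> \<le> real ?n * defect k"
    by (intro order_trans[OF sum_abs]) simp
  then have 1: "\<bar>(\<Sum>i<?n. ?f i - ?S i) / real ?n\<bar> \<le> defect k"
    using n by (simp add: abs_divide divide_le_eq mult.commute)
  have "(\<Sum>i<?n. ?S i) = (\<Sum>j<k. \<Sum>i<?n. \<phi> ((shift ^^ (i + j)) ?x))"
    by (rule sum.swap)
  also have "\<dots> = (\<Sum>j<k. \<Sum>i<?n. \<phi> ((shift ^^ i) ?x))"
    by (intro sum.cong refl sum_periodic_shift[where f = "\<lambda>i. \<phi> ((shift ^^ i) ?x)"]) simp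
  finally have 2: "(\<Sum>i<?n. ?S i) / real ?n = real k * orbit_average \<phi> xs"
    by (simp add: orbit_average_def)
  have "emp_rel_entropy k xs \<rho> = - word_entropy (empirical_prob xs) k - (\<Sum>i<?n. ?f i) / real ?n"
    unfolding emp_rel_entropy_def rel_entropy_word_entropy[OF stationary_family_empirical[OF assms]]
      empirical_expectation ..
  with 1 2 show ?thesis
    by (simp add: sum_subtractf diff_divide_distrib)
qed

section \<open>The right end point of the rate function\<close>

definition u_max :: real where
  "u_max = - (INF \<eta>\<in>ergodic_measures. \<integral>x. \<phi> x \<partial>\<eta>)"

lemma bdd_below_integrals: "bdd_below ((\<lambda>\<eta>. \<integral>x. \<phi> x \<partial>\<eta>) ` ergodic_measures)"
proof -
  obtain B where B: "\<And>x. \<bar>\<phi> x\<bar> \<le> B" using continuous_seq_bounded[OF cont] by auto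
  show ?thesis
  proof (rule bdd_belowI2)
    fix \<eta> :: "(nat \<Rightarrow> 'a) measure" assume "\<eta> \<in> ergodic_measures"
    then have inv: "\<eta> \<in> invariant_measures" by (simp add: ergodic_measures_def)
    interpret stationary_family "block_prob \<eta>" by (rule invariant_measures_stationary_family) fact
    have "\<bar>(\<integral>x. \<phi> x \<partial>\<eta>) - (\<Sum>w\<in>strings 0. block_prob \<eta> w * 0)\<bar> \<le> B"
      by (rule integral_cylinder_approx[OF cont invariant_measuresD[OF inv]]) (simp add: B)
    then show "- B \<le> (\<integral>x. \<phi> x \<partial>\<eta>)" by simp
  qed
qed

lemma orbit_average_ge: assumes "xs \<noteq> []" shows "- orbit_average \<phi> xs \<le> u_max"
  unfolding u_max_def integral_orbit_measure[OF assms cont, symmetric]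
  using cINF_lower[OF bdd_below_integrals orbit_measure_ergodic[OF assms]] by simp

lemma orbit_average_neg: assumes "xs \<noteq> []" shows "orbit_average \<phi> xs < 0"
proof -
  have "\<phi> x < 0" for x using g_function by (simp add: g_function_def)
  then have "(\<Sum>i<length xs. \<phi> ((shift ^^ i) (periodic_ext xs))) < (\<Sum>i<length xs. 0)"
    using assms by (intro sum_strict_mono) (auto simp: lessThan_empty_iff)
  then show ?thesis using assms by (simp add: orbit_average_def divide_less_0_iff)
qed

text \<open>
  Let \<open>\<eta>\<close> nearly minimise the integral of \<open>\<phi>\<close>. The \<open>\<eta>\<close>-mean of \<open>ln (r w)\<close> over words of length
  \<open>n\<close> is about \<open>n\<close> times this integral, because its increments in \<open>n\<close> are means of
  \<open>ln (r w) - ln (r (tl w))\<close>, which is close to \<open>\<phi>\<close>. Some word is at most the mean, and repeating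
  it periodically gives the orbit.
\<close>

lemma orbit_average_approx:
  assumes "0 < d" obtains xs where "xs \<noteq> []" "u_max - d < - orbit_average \<phi> xs"
proof -
  have "(INF \<eta>\<in>ergodic_measures. \<integral>x. \<phi> x \<partial>\<eta>) < - u_max + d / 2" using assms by (simp add: u_max_def)
  moreover have "ergodic_measures \<noteq> ({} :: (nat \<Rightarrow> 'a) measure set)" using orbit_measure_ergodic by blast
  ultimately obtain \<eta> where "\<eta> \<in> ergodic_measures" and \<eta>: "(\<integral>x. \<phi> x \<partial>\<eta>) < - u_max + d / 2"
    using cINF_less_iff[OF _ bdd_below_integrals] by blast
  then have inv: "\<eta> \<in> invariant_measures" by (simp add: ergodic_measures_def)
  interpret E: stationary_family "block_prob \<eta>" by (rule invariant_measures_stationary_family) fact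
  let ?I = "\<integral>x. \<phi> x \<partial>\<eta>"
  have step: "(\<Sum>w\<in>strings (Suc j). block_prob \<eta> w * ln (r w)) - (\<Sum>w\<in>strings j. block_prob \<eta> w * ln (r w))
      \<le> ?I + variation \<phi> (Suc j)" for j
  proof -
    have "\<bar>?I - (\<Sum>w\<in>strings (Suc j). block_prob \<eta> w * (ln (r w) - ln (r (tl w))))\<bar> \<le> variation \<phi> (Suc j)"
    proof (rule integral_cylinder_approx[OF cont invariant_measuresD[OF inv]])
      fix w :: "'a list" and x assume "w \<in> strings (Suc j)" and x: "x \<in> cylinder w"
      then obtain b u where "w = b # u" "length u = j" by (auto simp: strings_def length_Suc_conv)
      then show "\<bar>\<phi> x - (ln (r w) - ln (r (tl w)))\<bar> \<le> variation \<phi> (Suc j)"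
        using ln_ratio[of x b u] x by (auto simp: abs_minus_commute)
    qed
    moreover have "(\<Sum>w\<in>strings (Suc j). block_prob \<eta> w * ln (r (tl w))) = (\<Sum>w\<in>strings j. block_prob \<eta> w * ln (r w))"
      by (rule E.sum_Cons_tl)
    ultimately show ?thesis by (simp add: right_diff_distrib sum_subtractf abs_le_iff)
  qed
  have total: "(\<Sum>w\<in>strings n. block_prob \<eta> w * ln (r w)) \<le> real n * ?I + defect n" for n
  proof (induction n)
    case (Suc n) then show ?case using step[of n] by (simp add: defect_def algebra_simps)
  qed (simp add: strings_0 Nil E.Nil defect_def)
  have "(\<lambda>n. 2 * (defect n / real n) + 1 / real n) \<longlonglongrightarrow> 2 * 0 + 0"
    by (intro tendsto_intros defect_average lim_1_over_n)
  then have "\<forall>\<^sub>F n in sequentially. 2 * (defect n / real n) + 1 / real n < d / 2"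
    using assms by (intro order_tendstoD) auto
  then have "\<forall>\<^sub>F n in sequentially. 2 * (defect n / real n) + 1 / real n < d / 2 \<and> 0 < n"
    using eventually_gt_at_top[of 0] by (rule eventually_conj)
  then obtain n where n: "2 * (defect n / real n) + 1 / real n < d / 2" "0 < n"
    using eventually_happens by fastforce
  have "\<exists>u\<in>strings n. ln (r u) < real n * ?I + defect n + 1"
  proof (rule ccontr)
    assume "\<not> ?thesis"
    then have "(\<Sum>w\<in>strings n. block_prob \<eta> w * (real n * ?I + defect n + 1)) \<le> (\<Sum>w\<in>strings n. block_prob \<eta> w * ln (r w))"
      by (intro sum_mono mult_left_mono E.nonneg) (auto simp: not_less)
    then show False using total[of n] E.sum_strings[of n] by (simp flip: sum_distrib_right)
  qed
  then obtain u where u: "u \<in> strings n" "ln (r u) < real n * ?I + defect n + 1" by blast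
  then have len: "length u = n" and ne: "u \<noteq> []" using n(2) by (auto simp: strings_def)
  have "real n * orbit_average \<phi> u < real n * ?I + 2 * defect n + 1"
    using ln_block_prob_orbit_average[OF ne] u(2) unfolding len by linarith
  also have "\<dots> = real n * (?I + (2 * (defect n / real n) + 1 / real n))"
    using n(2) by (simp add: field_simps)
  also have "\<dots> < real n * (?I + d / 2)"
    using n by (intro mult_strict_left_mono) auto
  finally have "orbit_average \<phi> u < ?I + d / 2" using n(2) by simp
  then show thesis using that[OF ne] \<eta> by linarith
qed

end

section \<open>Periodic orbits and concentrated frequencies\<close>

lemma elog_upper:
  assumes "P \<le> exp (- real n * c)" "0 < n" "0 \<le> P"
  shows "ereal (1 / real n) * elog P \<le> ereal (- c)"
proof (cases "P = 0")
  case True then show ?thesis using assms(2) by (simp add: elog_def)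
next
  case False
  then have "ln P \<le> - real n * c" using assms(1,3) by (metis exp_gt_zero less_le ln_exp ln_le_cancel_iff)
  then have "1 / real n * ln P \<le> - c" using assms(2) by (simp add: field_simps)
  then show ?thesis using False by (simp add: elog_def)
qed

lemma elog_lower:
  assumes "exp (- real n * c) \<le> P" "0 < n"
  shows "ereal (- c) \<le> ereal (1 / real n) * elog P"
proof -
  have P: "0 < P" using assms(1) exp_gt_zero less_le_trans by blast
  then have "- real n * c \<le> ln P" using assms(1) by (simp add: ln_ge_iff)
  then have "- c \<le> 1 / real n * ln P" using assms(2) by (simp add: field_simps)
  then show ?thesis using P by (simp add: elog_def)
qed

lemma sum_periodic_bounded:
  fixes h :: "nat \<Rightarrow> real"
  assumes per: "\<And>i. h (i + p) = h i" and p: "0 < p" and zero: "(\<Sum>i<p. h i) = 0" and B: "\<And>i. \<bar>h i\<bar> \<le> B"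
  shows "\<bar>\<Sum>i<m. h i\<bar> \<le> real p * B"
proof (induction m rule: less_induct)
  case (less m)
  show ?case
  proof (cases "m < p")
    case True
    have "0 \<le> B" using B[of 0] by linarith
    have "\<bar>\<Sum>i<m. h i\<bar> \<le> (\<Sum>i<m. \<bar>h i\<bar>)" by (rule sum_abs)
    also have "\<dots> \<le> (\<Sum>i<m. B)" by (intro sum_mono B)
    also have "\<dots> \<le> real p * B" using True \<open>0 \<le> B\<close> by (simp add: mult_right_mono)
    finally show ?thesis .
  next
    case False
    have split: "(\<Sum>i<p + b. h i) = (\<Sum>i<p. h i) + (\<Sum>i<b. h (i + p))" for b
      by (induction b) (simp_all add: add.commute)
    have "(\<Sum>i<m. h i) = (\<Sum>i<m - p. h i)" using split[of "m - p"] False by (simp add: zero per)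
    then show ?thesis using less[of "m - p"] False p by simp
  qed
qed

context equilibrium
begin

lemma orbit_sum_bounded:
  assumes ys: "ys \<noteq> []"
  obtains D where "0 \<le> D"
    "\<And>i m. \<bar>(\<Sum>j<m. \<phi> ((shift ^^ (i + j)) (periodic_ext ys))) - real m * orbit_average \<phi> ys\<bar> \<le> D"
proof -
  let ?p = "length ys" and ?a = "orbit_average \<phi> ys" and ?y = "periodic_ext ys"
  obtain B where B: "\<And>x. \<bar>\<phi> x\<bar> \<le> B" using continuous_seq_bounded[OF cont] by auto
  have p: "0 < ?p" using ys by simp
  have "\<bar>(\<Sum>j<m. \<phi> ((shift ^^ (i + j)) ?y)) - real m * ?a\<bar> \<le> real ?p * (B + \<bar>?a\<bar>)" for i m
  proof -
    let ?h = "\<lambda>j. \<phi> ((shift ^^ (i + j)) ?y) - ?a"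
    have "\<bar>\<Sum>j<m. ?h j\<bar> \<le> real ?p * (B + \<bar>?a\<bar>)"
    proof (rule sum_periodic_bounded)
      show "?h (j + ?p) = ?h j" for j by (simp only: add.assoc[symmetric] funpow_shift_periodic_add)
      have "(\<Sum>j<?p. \<phi> ((shift ^^ (j + i)) ?y)) = (\<Sum>j<?p. \<phi> ((shift ^^ j) ?y))"
        by (rule sum_periodic_shift[where f = "\<lambda>j. \<phi> ((shift ^^ j) ?y)"]) simp
      then show "(\<Sum>j<?p. ?h j) = 0"
        using p by (simp add: sum_subtractf orbit_average_def add.commute)
      show "\<bar>?h j\<bar> \<le> B + \<bar>?a\<bar>" for j using B[of "(shift ^^ (i + j)) ?y"] by linarith
    qed (rule p)
    then show ?thesis by (simp add: sum_subtractf)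
  qed
  moreover have "0 \<le> real ?p * (B + \<bar>?a\<bar>)" using B[of undefined] by simp
  ultimately show thesis using that by blast
qed

text \<open>
  Gibbs' inequality against the reference weights obtained from \<open>r\<close> by the factor \<open>exp c\<close> on \<open>S\<close>:
  the factor contributes \<open>c\<close> times the mass of \<open>S\<close>, while the total weight grows by at most the
  number of words in \<open>S\<close>.
\<close>

lemma rel_entropy_concentrated:
  assumes "stationary_family \<nu>" and S: "S \<subseteq> strings k" and rS: "\<And>w. w \<in> S \<Longrightarrow> r w \<le> exp (- c)"
  shows "(\<Sum>w\<in>S. \<nu> w) * c - real (card S) \<le> rel_entropy k \<nu> \<rho>"
proof -
  interpret N: stationary_family \<nu> by fact
  have fS: "finite S" by (rule finite_subset[OF S]) simp
  define Q where "Q w = r w * exp (if w \<in> S then c else 0)" for w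
  have "(\<Sum>w\<in>strings k. Q w) \<le> (\<Sum>w\<in>strings k. r w + (if w \<in> S then 1 else 0))"
  proof (rule sum_mono)
    fix w show "Q w \<le> r w + (if w \<in> S then 1 else 0)"
    proof (cases "w \<in> S")
      case True
      have "r w * exp c \<le> exp (- c) * exp c" using rS[OF True] by (intro mult_right_mono) auto
      then show ?thesis using True nonneg[of w] by (simp add: Q_def flip: exp_add)
    qed (simp add: Q_def)
  qed
  also have "\<dots> = 1 + real (card S)"
    using S by (simp add: sum.distrib sum_strings sum.If_cases Int_absorb1)
  finally have sumQ: "(\<Sum>w\<in>strings k. Q w) \<le> 1 + real (card S)" .
  have Q0: "0 < Q w" for w unfolding Q_def using pos[of w] by simp
  have "(\<Sum>w\<in>strings k. \<nu> w) - (\<Sum>w\<in>strings k. Q w) \<le> (\<Sum>w\<in>strings k. \<nu> w * (ln (\<nu> w) - ln (Q w)))"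
    using Q0 by (intro gibbs_inequality) (auto simp: N.nonneg less_imp_le dest: less_imp_neq[OF Q0, symmetric, THEN notE])
  also have "\<dots> = (\<Sum>w\<in>strings k. \<nu> w * (ln (\<nu> w) - ln (r w)) - (if w \<in> S then \<nu> w * c else 0))"
    using less_imp_neq[OF pos, symmetric] by (intro sum.cong refl) (simp add: Q_def ln_mult algebra_simps)
  also have "\<dots> = rel_entropy k \<nu> \<rho> - (\<Sum>w\<in>S. \<nu> w) * c"
    using S by (simp add: sum_subtractf rel_entropy_eq[OF assms(1)] sum.If_cases Int_absorb1 sum_distrib_right)
  finally show ?thesis using sumQ by (simp add: N.sum_strings)
qed

section \<open>Expansion of the empirical relative entropies\<close>

text \<open>
  A common bound for the errors in all expansions of the two observables for strings of length \<open>n\<close>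
  and words of length \<open>k\<close>.
\<close>

definition err :: "nat \<Rightarrow> nat \<Rightarrow> real" where
  "err n k = defect n / real n + variation \<phi> k + defect k / real k"

lemma empirical_entropy_rate:
  fixes xs :: "'a list"
  assumes "xs \<noteq> []"
  shows "cond_entropy (empirical_prob xs) j \<le> word_entropy (empirical_prob xs) (Suc j) / real (Suc j)"
    "0 \<le> cond_entropy (empirical_prob xs) j"
proof -
  interpret stationary_family "empirical_prob xs" by (rule stationary_family_empirical) fact
  show "cond_entropy (empirical_prob xs) j \<le> word_entropy (empirical_prob xs) (Suc j) / real (Suc j)"
    using word_entropy_ge_cond_entropy[of j] by (simp add: field_simps)
  show "0 \<le> cond_entropy (empirical_prob xs) j" by (rule cond_entropy_nonneg)
qed

lemma emp_rel_entropy_rate_approx: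
  assumes "xs \<noteq> []" "0 < k"
  shows "\<bar>emp_rel_entropy k xs \<rho> / real k + word_entropy (empirical_prob xs) k / real k + orbit_average \<phi> xs\<bar>
    \<le> defect k / real k"
proof -
  have "emp_rel_entropy k xs \<rho> / real k + word_entropy (empirical_prob xs) k / real k + orbit_average \<phi> xs
    = (emp_rel_entropy k xs \<rho> - (- word_entropy (empirical_prob xs) k - real k * orbit_average \<phi> xs)) / real k"
    using assms(2) by (simp add: field_simps)
  then show ?thesis
    using emp_rel_entropy_approx[OF assms(1), of k] assms(2) by (simp add: abs_divide divide_right_mono)
qed

lemma err_nonneg: "0 \<le> err n m"
  unfolding err_def by (intro add_nonneg_nonneg divide_nonneg_nonneg defect_nonneg variation_nonneg cont) auto

lemma emp_cond_rel_entropy_nonneg: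
  assumes "xs \<noteq> []" "0 < m" shows "0 \<le> emp_cond_rel_entropy m xs \<rho>"
proof -
  obtain j where "m = Suc j" using assms(2) gr0_implies_Suc by blast
  then show ?thesis
    using cond_rel_entropy_nonneg[OF stationary_family_empirical[OF assms(1)]]
    by (simp add: emp_cond_rel_entropy_def)
qed

lemma emp_rel_entropy_nonneg:
  assumes "xs \<noteq> []" shows "0 \<le> emp_rel_entropy m xs \<rho>"
  unfolding emp_rel_entropy_def by (rule rel_entropy_nonneg[OF stationary_family_empirical[OF assms]])

text \<open>
  The first observable is, up to the error, minus the orbit average minus the conditional entropy. The
  second one has the block entropy per letter in place of the conditional entropy. The block entropy
  per letter is the larger of the two since conditional entropies decrease.
\<close>

lemma entropy_estimates:
  fixes xs :: "'a list"
  assumes xs: "xs \<noteq> []" and m: "0 < m"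
  defines "\<pi> \<equiv> empirical_prob xs" and "n \<equiv> length xs"
  shows emp_cond_rel_entropy_le:
      "emp_cond_rel_entropy m xs \<rho> + cond_entropy \<pi> (m - 1) \<le> - orbit_average \<phi> xs + err n m"
    and emp_rel_entropy_le:
      "emp_rel_entropy m xs \<rho> / real m + cond_entropy \<pi> (m - 1) \<le> - orbit_average \<phi> xs + err n m"
    and emp_cond_rel_entropy_ge:
      "emp_rel_entropy m xs \<rho> / real m - err n m \<le> emp_cond_rel_entropy m xs \<rho>"
proof -
  obtain j where j: "m = Suc j" using m gr0_implies_Suc by blast
  have e: "0 \<le> defect n / real n" "0 \<le> defect m / real m" "0 \<le> variation \<phi> m"
    using defect_nonneg variation_nonneg[OF cont] by auto
  have 1: "\<bar>emp_cond_rel_entropy m xs \<rho> - (- cond_entropy \<pi> (m - 1) - orbit_average \<phi> xs)\<bar> \<le> variation \<phi> m"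
    using emp_cond_rel_entropy_approx[OF xs, of j] by (simp add: j \<pi>_def)
  have 2: "\<bar>emp_rel_entropy m xs \<rho> / real m + word_entropy \<pi> m / real m + orbit_average \<phi> xs\<bar> \<le> defect m / real m"
    unfolding \<pi>_def by (rule emp_rel_entropy_rate_approx[OF xs m])
  have 3: "cond_entropy \<pi> (m - 1) \<le> word_entropy \<pi> m / real m"
    using empirical_entropy_rate(1)[OF xs, of j] by (simp add: j \<pi>_def)
  show "emp_cond_rel_entropy m xs \<rho> + cond_entropy \<pi> (m - 1) \<le> - orbit_average \<phi> xs + err n m"
    using 1 e unfolding err_def by linarith
  show "emp_rel_entropy m xs \<rho> / real m + cond_entropy \<pi> (m - 1) \<le> - orbit_average \<phi> xs + err n m"
    using 2 3 e unfolding err_def by linarith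
  show "emp_rel_entropy m xs \<rho> / real m - err n m \<le> emp_cond_rel_entropy m xs \<rho>"
    using 1 2 3 e unfolding err_def by linarith
qed

end

section \<open>The upper tail\<close>

text \<open>
  The properties of the two empirical relative entropies that determine their large deviations.
  \<open>Z_entropy\<close> is responsible for the upper bounds and \<open>Z_ge\<close> for the lower bound.
\<close>

locale entropy_observable = equilibrium g \<rho>
  for g :: "(nat \<Rightarrow> 'a::finite) \<Rightarrow> real" and \<rho> +
  fixes k :: "nat \<Rightarrow> nat" and \<epsilon> :: real and Z :: "nat \<Rightarrow> 'a list \<Rightarrow> real"
  assumes k_pos: "\<And>n. 0 < k n"
    and k_diverges: "filterlim k at_top sequentially"
    and eps: "0 < \<epsilon>" "\<epsilon> < 1"
    and k_bound: "\<forall>\<^sub>F n in sequentially. real (k n) \<le> (1 - \<epsilon>) / ln (real CARD('a)) * ln (real n)"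
    and Z_nonneg: "xs \<noteq> [] \<Longrightarrow> 0 \<le> Z (length xs) xs"
    and Z_entropy: "xs \<noteq> [] \<Longrightarrow> Z (length xs) xs + cond_entropy (empirical_prob xs) (k (length xs) - 1)
        \<le> - orbit_average \<phi> xs + err (length xs) (k (length xs))"
    and Z_ge: "xs \<noteq> [] \<Longrightarrow> emp_rel_entropy (k (length xs)) xs \<rho> / real (k (length xs)) - err (length xs) (k (length xs))
        \<le> Z (length xs) xs"
begin

lemma ln_card_pos: "0 < ln (real CARD('a))"
  using g_function_card_ge_2[OF g_function] by simp

lemma err_tendsto_0: "(\<lambda>n. err n (k n)) \<longlonglongrightarrow> 0"
proof -
  have "(\<lambda>n. defect n / real n + variation \<phi> (k n) + defect (k n) / real (k n)) \<longlonglongrightarrow> 0 + 0 + 0"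
    by (intro tendsto_add defect_average filterlim_compose[OF variation_tendsto_0[OF cont] k_diverges]
        filterlim_compose[OF defect_average k_diverges])
  then show ?thesis by (simp add: err_def)
qed

lemma k_over_n_tendsto_0: "(\<lambda>n. real (k n) / real n) \<longlonglongrightarrow> 0"
proof (rule Lim_null_comparison)
  show "\<forall>\<^sub>F n in sequentially. norm (real (k n) / real n) \<le> (1 - \<epsilon>) / ln (real CARD('a)) * ln (real n) / real n"
    using k_bound
  proof eventually_elim
    case (elim n)
    have "0 \<le> real (k n) / real n" by simp
    then show ?case using divide_right_mono[OF elim, of "real n"] by (simp only: real_norm_def abs_of_nonneg)
  qed
  have "(\<lambda>n. (1 - \<epsilon>) / ln (real CARD('a)) * (ln (real n) / real n)) \<longlonglongrightarrow> (1 - \<epsilon>) / ln (real CARD('a)) * 0"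
    by (intro tendsto_mult tendsto_const) real_asymp
  then show "(\<lambda>n. (1 - \<epsilon>) / ln (real CARD('a)) * ln (real n) / real n) \<longlonglongrightarrow> 0" by simp
qed

text \<open>
  The exponential rate of the number of count vectors and contexts. It tends to 0 since the number of
  words of length \<open>k n\<close> is at most \<open>n powr (1 - \<epsilon>)\<close>.
\<close>

definition type_rate :: "nat \<Rightarrow> real" where
  "type_rate n = (real CARD('a) ^ k n * ln (real n + 1) + real (k n) * ln (real CARD('a))) / real n"

lemma type_rate_tendsto_0: "type_rate \<longlonglongrightarrow> 0"
proof -
  have 1: "(\<lambda>n. real CARD('a) ^ k n * ln (real n + 1) / real n) \<longlonglongrightarrow> 0"
  proof (rule Lim_null_comparison)
    show "\<forall>\<^sub>F n in sequentially. norm (real CARD('a) ^ k n * ln (real n + 1) / real n)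
        \<le> real n powr (1 - \<epsilon>) * ln (real n + 1) / real n"
      using k_bound eventually_gt_at_top[of 0]
    proof eventually_elim
      case (elim n)
      have "real CARD('a) ^ k n = exp (real (k n) * ln (real CARD('a)))"
        by (simp add: exp_of_nat_mult)
      also have "\<dots> \<le> exp ((1 - \<epsilon>) * ln (real n))"
        using elim(1) ln_card_pos by (simp add: field_simps)
      also have "\<dots> = real n powr (1 - \<epsilon>)" using elim(2) by (simp add: powr_def)
      finally show ?case by (auto simp: abs_mult intro!: divide_right_mono mult_right_mono)
    qed
    show "(\<lambda>n. real n powr (1 - \<epsilon>) * ln (real n + 1) / real n) \<longlonglongrightarrow> 0"
      using eps by real_asymp
  qed
  have "(\<lambda>n. real CARD('a) ^ k n * ln (real n + 1) / real n + real (k n) / real n * ln (real CARD('a))) \<longlonglongrightarrow> 0 + 0 * ln (real CARD('a))"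
    by (intro tendsto_add tendsto_mult 1 k_over_n_tendsto_0 tendsto_const)
  then show ?thesis unfolding type_rate_def by (simp add: add_divide_distrib)
qed

definition slack :: "nat \<Rightarrow> real" where
  "slack n = 2 * err n (k n) + type_rate n"

lemma slack_tendsto_0: "slack \<longlonglongrightarrow> 0"
  unfolding slack_def using tendsto_add[OF tendsto_mult[OF tendsto_const[of 2] err_tendsto_0] type_rate_tendsto_0] by simp

lemma prob_le:
  assumes "xs \<noteq> []"
  defines "n \<equiv> length xs"
  shows "r xs \<le> exp (- real n * (Z n xs - 2 * err n (k n))) * exp (- real n * cond_entropy (empirical_prob xs) (k n - 1))"
proof -
  let ?h = "cond_entropy (empirical_prob xs) (k n - 1)"
  have n: "0 < real n" using assms by simp
  have "ln (r xs) \<le> real n * orbit_average \<phi> xs + defect n"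
    using ln_block_prob_orbit_average[OF assms(1)] unfolding n_def by linarith
  also have "\<dots> = real n * (orbit_average \<phi> xs + defect n / real n)"
    using n by (simp add: field_simps)
  also have "\<dots> \<le> real n * (- Z n xs - ?h + 2 * err n (k n))"
  proof (intro mult_left_mono)
    have "defect n / real n \<le> err n (k n)"
      unfolding err_def using variation_nonneg[OF cont] defect_nonneg by (simp add: add_nonneg_nonneg)
    then show "orbit_average \<phi> xs + defect n / real n \<le> - Z n xs - ?h + 2 * err n (k n)"
      using Z_entropy[OF assms(1)] unfolding n_def[symmetric] by linarith
  qed simp
  finally have "exp (ln (r xs)) \<le> exp (- real n * (Z n xs - 2 * err n (k n)) + - real n * ?h)"
    by (simp add: algebra_simps)
  then show ?thesis using pos[of xs] unfolding exp_add by simp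
qed

text \<open>
  By \<open>prob_le\<close> the probability of each string in the event is at most \<open>exp (- n u + o(n))\<close> times its
  maximal Markov likelihood, and these likelihoods have a subexponential sum.
\<close>

lemma upper_tail:
  assumes n: "0 < n"
  shows "strings_prob \<rho> {xs \<in> strings n. u \<le> Z n xs} \<le> exp (- real n * (u - slack n))"
proof -
  let ?h = "\<lambda>xs :: 'a list. exp (- real n * cond_entropy (empirical_prob xs) (k n - 1))"
  let ?e = "exp (- real n * (u - 2 * err n (k n)))"
  have "strings_prob \<rho> {xs \<in> strings n. u \<le> Z n xs} \<le> (\<Sum>xs\<in>{xs \<in> strings n. u \<le> Z n xs}. ?e * ?h xs)"
    unfolding strings_prob_def
  proof (rule sum_mono)
    fix xs assume "xs \<in> {xs \<in> strings n. u \<le> Z n xs}"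
    then have xs: "length xs = n" "xs \<noteq> []" "u \<le> Z n xs" using n by (auto simp: strings_def)
    have "r xs \<le> exp (- real n * (Z n xs - 2 * err n (k n))) * ?h xs"
      using prob_le[OF xs(2)] unfolding xs(1) .
    also have "\<dots> \<le> ?e * ?h xs" using xs(3) by (intro mult_right_mono) (auto intro!: mult_left_mono)
    finally show "r xs \<le> ?e * ?h xs" .
  qed
  also have "\<dots> \<le> (\<Sum>xs\<in>strings n. ?e * ?h xs)" by (intro sum_mono2) auto
  also have "\<dots> = ?e * (\<Sum>xs\<in>strings n. ?h xs)" by (simp add: sum_distrib_left)
  also have "\<dots> \<le> ?e * real ((n + 1) ^ (CARD('a) ^ Suc (k n - 1)) * CARD('a) ^ (k n - 1))"
    by (intro mult_left_mono sum_exp_cond_entropy_le n) auto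
  also have "\<dots> \<le> ?e * exp (real n * type_rate n)"
  proof (intro mult_left_mono)
    have k: "Suc (k n - 1) = k n" using k_pos[of n] by simp
    have "real ((n + 1) ^ (CARD('a) ^ Suc (k n - 1)) * CARD('a) ^ (k n - 1))
      = exp (real CARD('a) ^ k n * ln (real n + 1) + real (k n - 1) * ln (real CARD('a)))"
      unfolding k exp_add using exp_of_nat_mult[of "CARD('a) ^ k n" "ln (real n + 1)"]
      by (simp add: exp_of_nat_mult add.commute)
    also have "\<dots> \<le> exp (real n * type_rate n)"
      using n ln_card_pos k_pos[of n] by (simp add: type_rate_def mult_right_mono)
    finally show "real ((n + 1) ^ (CARD('a) ^ Suc (k n - 1)) * CARD('a) ^ (k n - 1)) \<le> exp (real n * type_rate n)" .
  qed simp
  also have "\<dots> = exp (- real n * (u - slack n))"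
    unfolding exp_add[symmetric] slack_def by (simp add: algebra_simps)
  finally show ?thesis .
qed

lemma Z_le:
  assumes "xs \<noteq> []" shows "Z (length xs) xs \<le> u_max + err (length xs) (k (length xs))"
  using Z_entropy[OF assms] orbit_average_ge[OF assms] empirical_entropy_rate(2)[OF assms, of "k (length xs) - 1"]
  by linarith

end

section \<open>The large deviation principle\<close>

lemma ereal_le_of_real_le:
  fixes x y :: ereal
  assumes "\<And>t. ereal t < x \<Longrightarrow> y \<le> - ereal t" shows "y \<le> - x"
proof (rule ccontr)
  assume "\<not> y \<le> - x"
  then obtain s where s: "- x < ereal s" "ereal s < y" using ereal_dense2[of "- x" y] by (auto simp: not_le)
  then have "ereal (- s) < x" by (metis ereal_uminus_less_reorder uminus_ereal.simps(1))
  from assms[OF this] s(2) show False by (simp add: not_le[symmetric])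
qed

context entropy_observable
begin

lemma prob_nonneg: "0 \<le> strings_prob \<rho> S"
  unfolding strings_prob_def by (intro sum_nonneg nonneg)

lemma strings_prob_mono: "S \<subseteq> T \<Longrightarrow> T \<subseteq> strings n \<Longrightarrow> strings_prob \<rho> S \<le> strings_prob \<rho> T"
  unfolding strings_prob_def
  by (intro sum_mono2) (auto intro: nonneg finite_subset)

text \<open>
  Since \<open>0 \<le> Z \<le> u_max + o(1)\<close>, the event is empty for large \<open>n\<close> if \<open>C\<close> misses \<open>[0, u_max]\<close>.
  Otherwise it is contained in an upper tail, because the rate function is the identity on
  \<open>[0, u_max]\<close>.
\<close>

lemma upper_bound:
  assumes C: "closed C"
  shows "limsup (\<lambda>n. ereal (1 / real n) * elog (strings_prob \<rho> {xs \<in> strings n. Z n xs \<in> C}))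
    \<le> - (INF u\<in>C. rate_J \<phi> u)"
proof (rule ereal_le_of_real_le)
  fix t assume t: "ereal t < (INF u\<in>C. rate_J \<phi> u)"
  have rate: "rate_J \<phi> u = (if u \<in> {0..u_max} then ereal u else \<infinity>)" for u
    by (simp add: rate_J_def u_max_def)
  have avoid: "t < u" if "u \<in> C" "0 \<le> u" "u \<le> u_max" for u
    using less_le_trans[OF t INF_lower[OF that(1)]] that by (simp add: rate)
  have "\<forall>\<^sub>F n in sequentially. \<forall>xs\<in>strings n. Z n xs \<in> C \<longrightarrow> t \<le> Z n xs"
  proof (cases "t \<le> u_max")
    case True
    show ?thesis using eventually_gt_at_top[of 0]
    proof eventually_elim
      case (elim n)
      show ?case
      proof (intro ballI impI)
        fix xs assume "xs \<in> strings n" and C: "Z n xs \<in> C"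
        then have "length xs = n" "xs \<noteq> []" using elim by (auto simp: strings_def)
        then have "0 \<le> Z n xs" using Z_nonneg by blast
        then show "t \<le> Z n xs" using avoid[OF C] True by linarith
      qed
    qed
  next
    case False
    \<comment> \<open>The closed set \<open>C\<close> has a positive distance from \<open>u_max\<close>, which absorbs the error in \<open>Z_le\<close>.\<close>
    have "u_max \<notin> C"
      using avoid[of u_max] False orbit_average_ge[of "[undefined]"] orbit_average_neg[of "[undefined]"] by fastforce
    then obtain d where d: "0 < d" "ball u_max d \<subseteq> - C"
      using C by (metis ComplI open_Compl openE)
    have "\<forall>\<^sub>F n in sequentially. err n (k n) < d"
      using err_tendsto_0 d(1) by (rule order_tendstoD)
    then show ?thesis using eventually_gt_at_top[of 0]
    proof eventually_elim
      case (elim n)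
      show ?case
      proof (intro ballI impI)
        fix xs assume "xs \<in> strings n" and ZC: "Z n xs \<in> C"
        then have xs: "length xs = n" "xs \<noteq> []" using elim by (auto simp: strings_def)
        have Z0: "0 \<le> Z n xs" using Z_nonneg xs by blast
        have Z1: "Z n xs < u_max + d" using Z_le[OF xs(2)] elim xs(1) by auto
        have "\<not> Z n xs \<le> u_max" using avoid[OF ZC Z0] False by linarith
        then have "Z n xs \<in> ball u_max d" using Z1 by (simp add: dist_real_def)
        then show "t \<le> Z n xs" using d(2) ZC by blast
      qed
    qed
  qed
  then have "\<forall>\<^sub>F n in sequentially.
      ereal (1 / real n) * elog (strings_prob \<rho> {xs \<in> strings n. Z n xs \<in> C}) \<le> ereal (- (t - slack n))"
    using eventually_gt_at_top[of 0]
  proof eventually_elim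
    case (elim n)
    have "strings_prob \<rho> {xs \<in> strings n. Z n xs \<in> C} \<le> strings_prob \<rho> {xs \<in> strings n. t \<le> Z n xs}"
      using elim(1) by (intro strings_prob_mono) auto
    also have "\<dots> \<le> exp (- real n * (t - slack n))" by (rule upper_tail) fact
    finally show ?case using elim(2) prob_nonneg by (intro elog_upper)
  qed
  then have "limsup (\<lambda>n. ereal (1 / real n) * elog (strings_prob \<rho> {xs \<in> strings n. Z n xs \<in> C}))
      \<le> limsup (\<lambda>n. ereal (- (t - slack n)))"
    by (rule Limsup_mono)
  also have "\<dots> = ereal (- (t - 0))"
    by (intro lim_imp_Limsup tendsto_intros slack_tendsto_0) simp
  finally show "limsup (\<lambda>n. ereal (1 / real n) * elog (strings_prob \<rho> {xs \<in> strings n. Z n xs \<in> C})) \<le> - ereal t"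
    by simp
qed

definition tail_event :: "'a list \<Rightarrow> nat \<Rightarrow> nat \<Rightarrow> 'a list set" where
  "tail_event ys n l = {xs \<in> strings n. drop (n - l) xs = window (periodic_ext ys) 0 l}"

lemma tail_event_prob:
  assumes "l \<le> n"
  shows "strings_prob \<rho> (tail_event ys n l) = r (window (periodic_ext ys) 0 l)"
proof -
  let ?z = "window (periodic_ext ys) 0 l"
  have "tail_event ys n l = (\<lambda>u. u @ ?z) ` strings (n - l)"
  proof (intro equalityI subsetI)
    fix xs assume "xs \<in> tail_event ys n l"
    then have "xs = take (n - l) xs @ ?z" "take (n - l) xs \<in> strings (n - l)"
      using append_take_drop_id[of "n - l" xs] by (auto simp: tail_event_def strings_def)
    then show "xs \<in> (\<lambda>u. u @ ?z) ` strings (n - l)" by blast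
  qed (use assms in \<open>auto simp: tail_event_def strings_def\<close>)
  then show ?thesis
    unfolding strings_prob_def using sum_prefix[of ?z "n - l"] by (simp add: sum.reindex inj_on_def)
qed

lemma tail_event_prob_ge:
  assumes "ys \<noteq> []" "l \<le> n"
    and D: "\<And>i m. \<bar>(\<Sum>j<m. \<phi> ((shift ^^ (i + j)) (periodic_ext ys))) - real m * orbit_average \<phi> ys\<bar> \<le> D"
  shows "exp (real l * orbit_average \<phi> ys - D - defect n) \<le> strings_prob \<rho> (tail_event ys n l)"
proof -
  have "real l * orbit_average \<phi> ys - D - defect n \<le> ln (r (window (periodic_ext ys) 0 l))"
    using ln_window[of "periodic_ext ys" 0 l] D[of 0 l] defect_mono[OF assms(2)]
    unfolding defect_def[of l, symmetric] by linarith
  then show ?thesis unfolding tail_event_prob[OF assms(2)] using pos by (simp add: ln_ge_iff)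
qed

text \<open>
  The windows of length \<open>j\<close> inside the last \<open>l\<close> letters all belong to the at most \<open>length ys\<close>
  words of the periodic orbit, each of which has probability about \<open>exp (- j a)\<close> with \<open>- a\<close> the
  orbit average. So the empirical frequencies are concentrated as required in
  \<open>rel_entropy_concentrated\<close>.
\<close>

lemma tail_event_rel_entropy:
  assumes ys: "ys \<noteq> []" and l: "l \<le> n" and n: "0 < n" and xs: "xs \<in> tail_event ys n l" and j: "0 < j"
    and D: "\<And>i m. \<bar>(\<Sum>j<m. \<phi> ((shift ^^ (i + j)) (periodic_ext ys))) - real m * orbit_average \<phi> ys\<bar> \<le> D"
  shows "(real l - real j) / real n * (- orbit_average \<phi> ys) - (D + defect j + real (length ys)) / real j
    \<le> emp_rel_entropy j xs \<rho> / real j"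
proof -
  let ?y = "periodic_ext ys" and ?x = "periodic_ext xs" and ?a = "- orbit_average \<phi> ys"
  have len: "length xs = n" and ne: "xs \<noteq> []" and tail: "drop (n - l) xs = window ?y 0 l"
    using xs n by (auto simp: tail_event_def strings_def)
  interpret E: stationary_family "empirical_prob xs" by (rule stationary_family_empirical) fact
  have a: "0 < ?a" using orbit_average_neg[OF ys] by simp
  have D0: "0 \<le> D" using D[of 0 0] by linarith
  define S where "S = (\<lambda>i. window ?y i j) ` {..<length ys}"
  define M where "M = (\<Sum>w\<in>S. empirical_prob xs w)"
  have Smem: "window ?y i j \<in> S" for i
  proof -
    have "window ?y i j = window ?y (i mod length ys) j"
      by (simp add: list_eq_iff_nth_eq periodic_ext_def mod_add_left_eq)
    then show ?thesis unfolding S_def using ys by (auto intro!: imageI)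
  qed
  have Ssub: "S \<subseteq> strings j" by (auto simp: S_def)
  have M1: "M \<le> 1"
    unfolding M_def E.sum_strings[of j, symmetric] using Ssub by (intro sum_mono2) (auto intro: E.nonneg)
  have "(real l - real j) / real n \<le> M"
  proof -
    have "M = (\<Sum>w\<in>strings j. empirical_prob xs w * indicator S w)"
      unfolding M_def using Ssub by (simp add: indicator_def sum.If_cases Int_absorb1 if_distrib cong: if_cong)
    also have "\<dots> = (\<Sum>i<n. indicator S (window ?x i j)) / real n"
      unfolding empirical_expectation len ..
    finally have M: "M = (\<Sum>i<n. indicator S (window ?x i j)) / real n" .
    have "window ?x i j \<in> S" if i: "n - l \<le> i" "i < n - j" for i
    proof -
      have "window ?x i j = window ?y (i - (n - l)) j"
      proof (rule nth_equalityI)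
        fix m assume "m < length (window ?x i j)"
        then have m: "m < j" by simp
        have "?x (i + m) = drop (n - l) xs ! (i - (n - l) + m)"
          using i m l len by (simp add: periodic_ext_def)
        also have "\<dots> = ?y (i - (n - l) + m)" unfolding tail using i m l by simp
        finally show "window ?x i j ! m = window ?y (i - (n - l)) j ! m" using m by simp
      qed simp
      then show ?thesis using Smem by simp
    qed
    then have "(\<Sum>i\<in>{n - l..<n - j}. 1 :: real) \<le> (\<Sum>i\<in>{n - l..<n - j}. indicator S (window ?x i j))"
      by (intro sum_mono) auto
    also have "\<dots> \<le> (\<Sum>i<n. indicator S (window ?x i j))" by (intro sum_mono2) auto
    finally have "real (n - j - (n - l)) \<le> (\<Sum>i<n. indicator S (window ?x i j))" by simp
    moreover have "real l - real j \<le> real (n - j - (n - l))" using l by linarith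
    ultimately show ?thesis unfolding M by (intro divide_right_mono) auto
  qed
  then have frac: "(real l - real j) / real n * ?a \<le> M * ?a" using a by (intro mult_right_mono) auto
  have "M * (real j * ?a - D - defect j) - real (card S) \<le> emp_rel_entropy j xs \<rho>"
    unfolding M_def emp_rel_entropy_def
  proof (rule rel_entropy_concentrated[OF E.stationary_family_axioms Ssub])
    fix w assume "w \<in> S"
    then obtain i where w: "w = window ?y i j" by (auto simp: S_def)
    have "ln (r w) \<le> - (real j * ?a - D - defect j)"
      using ln_window[of ?y i j] D[of i j] unfolding w defect_def[symmetric] by (simp add: abs_le_iff)
    then show "r w \<le> exp (- (real j * ?a - D - defect j))" using pos[of w] by (metis exp_le_cancel_iff exp_ln)
  qed
  then have conc: "real j * (M * ?a) - M * (D + defect j) - real (card S) \<le> emp_rel_entropy j xs \<rho>"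
    by (simp add: algebra_simps)
  have card: "real (card S) \<le> real (length ys)"
    unfolding S_def using card_image_le[of "{..<length ys}" "\<lambda>i. window ?y i j"] by simp
  have MD: "M * (D + defect j) \<le> D + defect j"
    using mult_right_mono[OF M1, of "D + defect j"] D0 defect_nonneg[of j] by simp
  have lin: "X - (b + c) \<le> R" if "X \<le> Y" "Y - V - t \<le> R" "t \<le> c" "V \<le> b" for X Y V t b c R :: real
    using that by linarith
  have "real j * ((real l - real j) / real n * ?a) - (D + defect j + real (length ys)) \<le> emp_rel_entropy j xs \<rho>"
    by (rule lin[OF _ conc card MD]) (intro mult_left_mono frac, simp)
  then have "(real j * ((real l - real j) / real n * ?a) - (D + defect j + real (length ys))) / real j
      \<le> emp_rel_entropy j xs \<rho> / real j" by (intro divide_right_mono) auto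
  then show ?thesis using j by (simp add: diff_divide_distrib)
qed

text \<open>
  The tail events for \<open>l = s n\<close> have probability at least \<open>exp (- n u - o(n))\<close>, and \<open>Z\<close> is at least
  \<open>u - o(1)\<close> on them. The part where \<open>Z \<ge> u + d\<close> is exponentially smaller by \<open>upper_tail\<close>, so
  most of the tail event lies in the window around \<open>u\<close>, whatever the initial letters do.
\<close>

lemma local_lower_bound:
  assumes ys: "ys \<noteq> []" and s: "0 \<le> s" "s \<le> 1" and d: "0 < d"
  defines "u \<equiv> s * - orbit_average \<phi> ys"
  shows "ereal (- u) \<le> liminf (\<lambda>n. ereal (1 / real n) *
    elog (strings_prob \<rho> {xs \<in> strings n. u - d < Z n xs \<and> Z n xs < u + d}))"
proof -
  let ?a = "- orbit_average \<phi> ys"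
  have a: "0 < ?a" using orbit_average_neg[OF ys] by simp
  obtain D where D0: "0 \<le> D" and
    D: "\<And>i m. \<bar>(\<Sum>j<m. \<phi> ((shift ^^ (i + j)) (periodic_ext ys))) - real m * orbit_average \<phi> ys\<bar> \<le> D"
    using orbit_sum_bounded[OF ys] by metis
  define l where "l n = nat \<lfloor>s * real n\<rfloor>" for n
  have l: "real (l n) \<le> s * real n" "s * real n - 1 \<le> real (l n)" for n
  proof -
    have "0 \<le> s * real n" using s by simp
    then have "real (l n) = real_of_int \<lfloor>s * real n\<rfloor>" unfolding l_def by simp
    then show "real (l n) \<le> s * real n" "s * real n - 1 \<le> real (l n)" by linarith+
  qed
  have ln: "l n \<le> n" for n
  proof -
    have "real (l n) \<le> 1 * real n" using l(1)[of n] mult_right_mono[OF s(2), of "real n"] by linarith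
    then show ?thesis by simp
  qed
  define \<alpha> where "\<alpha> n = D / real n + defect n / real n" for n
  define \<beta> where "\<beta> n = (1 / real n + real (k n) / real n) * ?a + (D + real (length ys)) / real (k n)
      + defect (k n) / real (k n) + err n (k n)" for n
  have Dn: "(\<lambda>n. c / real n) \<longlonglongrightarrow> 0" for c :: real
    by (rule tendsto_divide_0[OF tendsto_const filterlim_at_top_imp_at_infinity[OF filterlim_real_sequentially]])
  have \<alpha>0: "\<alpha> \<longlonglongrightarrow> 0"
    unfolding \<alpha>_def using tendsto_add[OF Dn defect_average] by simp
  have \<beta>0: "\<beta> \<longlonglongrightarrow> 0"
  proof -
    have "(\<lambda>n. (1 / real n + real (k n) / real n) * ?a + (D + real (length ys)) / real (k n)
      + defect (k n) / real (k n) + err n (k n)) \<longlonglongrightarrow> (0 + 0) * ?a + 0 + 0 + 0"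
      by (intro tendsto_add tendsto_mult tendsto_const Dn k_over_n_tendsto_0 err_tendsto_0
          filterlim_compose[OF Dn k_diverges] filterlim_compose[OF defect_average k_diverges])
    then show ?thesis unfolding \<beta>_def by simp
  qed
  have E_ge: "exp (- real n * (u + \<alpha> n)) \<le> strings_prob \<rho> (tail_event ys n (l n))" if n: "0 < n" for n
  proof -
    have "real (l n) * ?a \<le> s * real n * ?a" using l(1)[of n] a by (intro mult_right_mono) auto
    then have "- real n * (u + \<alpha> n) \<le> real (l n) * orbit_average \<phi> ys - D - defect n"
      using n by (simp add: u_def \<alpha>_def algebra_simps)
    then have "exp (- real n * (u + \<alpha> n)) \<le> exp (real (l n) * orbit_average \<phi> ys - D - defect n)" by simp
    also have "\<dots> \<le> strings_prob \<rho> (tail_event ys n (l n))"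
      by (rule tail_event_prob_ge[OF ys ln D])
    finally show ?thesis .
  qed
  have Z_E: "u - \<beta> n \<le> Z n xs" if n: "0 < n" and xs: "xs \<in> tail_event ys n (l n)" for n xs
  proof -
    have len: "length xs = n" "xs \<noteq> []" using xs n by (auto simp: tail_event_def strings_def)
    have "s - (1 / real n + real (k n) / real n) = (s * real n - 1 - real (k n)) / real n"
      using n by (simp add: field_simps)
    also have "\<dots> \<le> (real (l n) - real (k n)) / real n"
      using l(2)[of n] by (intro divide_right_mono) auto
    finally have "(s - (1 / real n + real (k n) / real n)) * ?a \<le> (real (l n) - real (k n)) / real n * ?a"
      using a by (intro mult_right_mono) auto
    then have "u - \<beta> n \<le> (real (l n) - real (k n)) / real n * ?a
        - (D + defect (k n) + real (length ys)) / real (k n) - err n (k n)"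
      unfolding u_def \<beta>_def by (simp add: left_diff_distrib add_divide_distrib)
    also have "\<dots> \<le> emp_rel_entropy (k n) xs \<rho> / real (k n) - err n (k n)"
      using tail_event_rel_entropy[OF ys ln n xs k_pos D] by (intro diff_right_mono)
    also have "\<dots> \<le> Z n xs" using Z_ge[OF len(2)] len(1) by simp
    finally show ?thesis .
  qed
  have "\<forall>\<^sub>F n in sequentially. \<beta> n < d" using \<beta>0 d by (rule order_tendstoD)
  moreover have "\<forall>\<^sub>F n in sequentially. \<alpha> n + slack n < d / 2"
  proof -
    have "(\<lambda>n. \<alpha> n + slack n) \<longlonglongrightarrow> 0" using tendsto_add[OF \<alpha>0 slack_tendsto_0] by simp
    then show ?thesis using d by (intro order_tendstoD) auto
  qed
  moreover have "\<forall>\<^sub>F n in sequentially. ln 2 / real n < d / 2"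
    using Dn d by (intro order_tendstoD) auto
  ultimately have "\<forall>\<^sub>F n in sequentially. ereal (- (u + \<alpha> n + ln 2 / real n)) \<le> ereal (1 / real n) *
      elog (strings_prob \<rho> {xs \<in> strings n. u - d < Z n xs \<and> Z n xs < u + d})"
    using eventually_gt_at_top[of 0]
  proof eventually_elim
    case (elim n)
    let ?W = "{xs \<in> strings n. u - d < Z n xs \<and> Z n xs < u + d}" and ?T = "{xs \<in> strings n. u + d \<le> Z n xs}"
    let ?e = "exp (- real n * (u + \<alpha> n + ln 2 / real n))"
    \<comment> \<open>The summand \<open>ln 2 / n\<close> in the rate halves the lower bound; the other half pays for the upper tail.\<close>
    have e: "exp (- real n * (u + \<alpha> n)) = 2 * ?e"
    proof -
      have "- real n * (u + \<alpha> n) = ln 2 + - real n * (u + \<alpha> n + ln 2 / real n)"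
        using elim(4) by (simp add: field_simps)
      then show ?thesis by (simp only: exp_add) simp
    qed
    have "tail_event ys n (l n) \<subseteq> ?W \<union> ?T"
    proof
      fix xs assume xs: "xs \<in> tail_event ys n (l n)"
      then show "xs \<in> ?W \<union> ?T" using Z_E[OF elim(4) xs] elim(1) by (auto simp: tail_event_def)
    qed
    then have "strings_prob \<rho> (tail_event ys n (l n)) \<le> strings_prob \<rho> (?W \<union> ?T)"
      by (rule strings_prob_mono[of _ _ n]) auto
    also have "\<dots> = strings_prob \<rho> ?W + strings_prob \<rho> ?T"
      unfolding strings_prob_def by (rule sum.union_disjoint) auto
    finally have "2 * ?e \<le> strings_prob \<rho> ?W + strings_prob \<rho> ?T" using E_ge[OF elim(4)] e by linarith
    moreover have "strings_prob \<rho> ?T \<le> ?e"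
    proof -
      have "u + \<alpha> n + ln 2 / real n \<le> u + d - slack n" using elim(2,3) by linarith
      then have "exp (- real n * (u + d - slack n)) \<le> ?e" by (simp add: mult_left_mono)
      then show ?thesis using upper_tail[OF elim(4), of "u + d"] by linarith
    qed
    ultimately have "?e \<le> strings_prob \<rho> ?W" by linarith
    then show ?case using elim(4) by (rule elog_lower)
  qed
  then have "liminf (\<lambda>n. ereal (- (u + \<alpha> n + ln 2 / real n))) \<le> liminf (\<lambda>n. ereal (1 / real n) *
      elog (strings_prob \<rho> {xs \<in> strings n. u - d < Z n xs \<and> Z n xs < u + d}))"
    by (rule Liminf_mono)
  moreover have "liminf (\<lambda>n. ereal (- (u + \<alpha> n + ln 2 / real n))) = ereal (- (u + 0 + 0))"
    by (intro lim_imp_Liminf tendsto_intros \<alpha>0 Dn) simp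
  ultimately show ?thesis by simp
qed

lemma elog_mono: "0 \<le> P \<Longrightarrow> P \<le> Q \<Longrightarrow> elog P \<le> elog Q"
  by (auto simp: elog_def)

text \<open>
  A rate \<open>u\<close> in \<open>[0, u_max]\<close> is approximated from below by \<open>u' = s a\<close> with \<open>s = u / u_max\<close> and a
  periodic orbit of average \<open>- a\<close> close to \<open>- u_max\<close>. Approximation from below only improves the
  bound.
\<close>

lemma lower_bound:
  assumes U: "open U"
  shows "- (INF u\<in>U. rate_J \<phi> u)
    \<le> liminf (\<lambda>n. ereal (1 / real n) * elog (strings_prob \<rho> {xs \<in> strings n. Z n xs \<in> U}))"
    (is "_ \<le> ?l")
proof -
  have rate: "rate_J \<phi> u = (if u \<in> {0..u_max} then ereal u else \<infinity>)" for u
    by (simp add: rate_J_def u_max_def)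
  have "- ?l \<le> (INF u\<in>U. rate_J \<phi> u)"
  proof (rule INF_greatest)
    fix u assume u: "u \<in> U"
    show "- ?l \<le> rate_J \<phi> u"
    proof (cases "u \<in> {0..u_max}")
      case True
      obtain d where d: "0 < d" "ball u d \<subseteq> U" using U u by (meson openE)
      obtain ys where ys: "ys \<noteq> []" "u_max - d / 2 < - orbit_average \<phi> ys"
        using orbit_average_approx[of "d / 2"] d(1) by auto
      define a where "a = - orbit_average \<phi> ys"
      have a: "0 < a" "a \<le> u_max" "u_max - d / 2 < a"
        using orbit_average_neg[OF ys(1)] orbit_average_ge[OF ys(1)] ys(2) by (auto simp: a_def)
      define u' where "u' = u / u_max * a"
      have s: "0 \<le> u / u_max" "u / u_max \<le> 1" using True a by (auto simp: divide_le_eq_1)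
      have u': "u' \<le> u" "u - u' \<le> d / 2"
      proof -
        have eq: "u - u' = u / u_max * (u_max - a)" using a by (simp add: u'_def field_simps)
        have "0 \<le> u - u'" unfolding eq using s a by (intro mult_nonneg_nonneg) auto
        then show "u' \<le> u" by linarith
        have "u - u' \<le> 1 * (u_max - a)" unfolding eq using s a by (intro mult_right_mono) auto
        also have "1 * (u_max - a) \<le> d / 2" using a(3) by (simp add: field_simps)
        finally show "u - u' \<le> d / 2" .
      qed
      have sub: "{xs \<in> strings n. u' - d / 2 < Z n xs \<and> Z n xs < u' + d / 2} \<subseteq> {xs \<in> strings n. Z n xs \<in> U}" for n
        using u' d by (auto simp: subset_iff dist_real_def abs_less_iff)
      have "ereal (- u') \<le> liminf (\<lambda>n. ereal (1 / real n) *
          elog (strings_prob \<rho> {xs \<in> strings n. u' - d / 2 < Z n xs \<and> Z n xs < u' + d / 2}))"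
        unfolding u'_def a_def by (rule local_lower_bound[OF ys(1) s]) (use d in simp)
      also have "\<dots> \<le> ?l"
        by (intro Liminf_mono always_eventually allI ereal_mult_left_mono elog_mono prob_nonneg
            strings_prob_mono[OF sub]) auto
      finally have "ereal (- u) \<le> ?l" using u'(1) by (meson ereal_less_eq(3) neg_le_iff_le order_trans)
      then show ?thesis using True by (simp add: rate ereal_uminus_le_reorder)
    qed (auto simp: rate)
  qed
  then show ?thesis by (simp add: ereal_uminus_le_reorder)
qed

theorem large_deviation_principle: "satisfies_LDP \<rho> Z (rate_J \<phi>)"
  unfolding satisfies_LDP_def using upper_bound lower_bound by blast

end

theorem theorem3p2:
  fixes g :: "(nat \<Rightarrow> 'a::finite) \<Rightarrow> real"
    and \<rho> :: "(nat \<Rightarrow> 'a) measure"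
    and k :: "nat \<Rightarrow> nat"
    and \<epsilon> :: real
  assumes g: "g_measure g \<rho>"
    and k_pos: "\<And>n. k n > 0"
    and k_diverges: "filterlim k at_top sequentially"
    and eps: "0 < \<epsilon>" "\<epsilon> < 1"
    and k_bound: "\<forall>\<^sub>F n in sequentially. real (k n) \<le> (1 - \<epsilon>) / ln (real CARD('a)) * ln (real n)"
  shows "satisfies_LDP \<rho> (\<lambda>n xs. emp_cond_rel_entropy (k n) xs \<rho>) (rate_J (\<lambda>x. ln (g x)))
       \<and> satisfies_LDP \<rho> (\<lambda>n xs. emp_rel_entropy (k n) xs \<rho> / real (k n)) (rate_J (\<lambda>x. ln (g x)))"
proof
  have e: "equilibrium g \<rho>" by (rule equilibrium.intro) (rule g)
  interpret equilibrium g \<rho> by (rule e)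
  have "entropy_observable g \<rho> k \<epsilon> (\<lambda>n xs. emp_cond_rel_entropy (k n) xs \<rho>)"
    by (intro entropy_observable.intro entropy_observable_axioms.intro e k_pos k_diverges eps k_bound
        emp_cond_rel_entropy_nonneg emp_cond_rel_entropy_le emp_cond_rel_entropy_ge)
  then show "satisfies_LDP \<rho> (\<lambda>n xs. emp_cond_rel_entropy (k n) xs \<rho>) (rate_J (\<lambda>x. ln (g x)))"
    by (rule entropy_observable.large_deviation_principle)
  have "entropy_observable g \<rho> k \<epsilon> (\<lambda>n xs. emp_rel_entropy (k n) xs \<rho> / real (k n))"
  proof (intro entropy_observable.intro entropy_observable_axioms.intro e k_pos k_diverges eps k_bound
      emp_rel_entropy_le divide_nonneg_nonneg emp_rel_entropy_nonneg)
    fix xs :: "'a list"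
    show "emp_rel_entropy (k (length xs)) xs \<rho> / real (k (length xs)) - err (length xs) (k (length xs))
        \<le> emp_rel_entropy (k (length xs)) xs \<rho> / real (k (length xs))"
      using err_nonneg by simp
  qed simp_all
  then show "satisfies_LDP \<rho> (\<lambda>n xs. emp_rel_entropy (k n) xs \<rho> / real (k n)) (rate_J (\<lambda>x. ln (g x)))"
    by (rule entropy_observable.large_deviation_principle)
qed

end
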